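(* Let $M$ be a closed regular simple convex planar curve. If $M$ is not a curve of constant width, then $$4\left|\widetilde{A}_{\mathrm{SMS}(M)}\right|=8\left|\widetilde{A}_{E_{1/2}(M)}\right|+\left|\widetilde{A}_{\mathrm{CWMS}(M)}\right|,$$ and otherwise $$\mathrm{SMS}(M)=E_{1/2}(M),\qquad \mathrm{CWMS}(M)=\{\Theta\}.$$ Here $\widetilde A_{E_{1/2}(M)}$, $\widetilde A_{\mathrm{CWMS}(M)}$, $\widetilde A_{\mathrm{SMS}(M)}$ are the oriented areas of the Wigner caustic, the Constant Width Measure Set and the Spherical Measure Set of $M$, respectively, and $\Theta$ is the origin of the vector space $\mathbb R^2$.
   Context: Curves are $C^\infty$. A regular closed curve is convex if its signed curvature has a constant sign (curvature nowhere zero, positive for the positive orientation). A closed regular simple convex planar curve is called an oval; orient $M$ positively and let $L_M$ be its length. It is of constant width if the distance between parallel tangent lines is constant. Taking an origin $\Theta$ inside $M$, let $p(\theta)$ be the Minkowski support function of $M$; $M$ is parameterized by $\gamma(\theta)=(p(\theta)\cos\theta-p'(\theta)\sin\theta,\ p(\theta)\sin\theta+p'(\theta)\cos\theta)$. An ordered pair $a\ne b$ of points of $M$ is a parallel pair if the tangent lines to $M$ at $a$ and $b$ are parallel; the parallel pairs are $\gamma(\theta),\gamma(\theta+\pi)$. Let $\mathbf n$ be the continuous unit normal field to $M$ compatible with the orientation, i.e. $\mathbf n(\gamma(\theta))=-(\cos\theta,\sin\theta)$, and let $\overline w_M=L_M/\pi$ (average width). Wigner caustic: $E_{1/2}(M)=\{\frac12(a+b):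 a,b\text{ a parallel pair}\}$, parameterized by $\frac12(\gamma(\theta)+\gamma(\theta+\pi))$ and traversed once, $\theta\in[0,\pi]$. $\mathrm{CWMS}(M)=\{a-b+\overline w_M\mathbf n(a): a,b\text{ a parallel pair}\}$, parameterized by $\gamma(\theta)-\gamma(\theta+\pi)+\overline w_M\mathbf n(\gamma(\theta))$, $\theta\in[0,2\pi]$; it is a subset of the vector space $\mathbb R^2$ with origin $\Theta$. $\mathrm{SMS}(M)=\{a+\frac{L_M}{2\pi}\mathbf n(a): a\in M\}$, parameterized by $\gamma(\theta)+\frac{L_M}{2\pi}\mathbf n(\gamma(\theta))$, $\theta\in[0,2\pi]$, when $M$ is not of constant width. The oriented area of an oriented closed curve $C$ is $\widetilde A_C=\frac12\int_C -y\,dx+x\,dy$ (zero if $C$ degenerates to a point). *)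

theory Defs
  imports "HOL-Analysis.Analysis"
begin

text \<open>
  A closed curve of period \<open>T\<close> is a periodic map \<open>M :: real \<Rightarrow> real ^ 2\<close>; its point set is
  \<open>range M\<close>. The origin of the plane is \<open>0\<close>.
\<close>

definition velocity :: "(real \<Rightarrow> real ^ 2) \<Rightarrow> real \<Rightarrow> real ^ 2" where
  "velocity M = (\<lambda>t. vector_derivative M (at t))"

definition smooth_curve :: "(real \<Rightarrow> real ^ 2) \<Rightarrow> bool" where
  "smooth_curve M \<longleftrightarrow> (\<forall>k t. (velocity ^^ k) M differentiable (at t))"

definition closed_regular_simple_curve :: "(real \<Rightarrow> real ^ 2) \<Rightarrow> real \<Rightarrow> bool" where
  "closed_regular_simple_curve M T \<longleftrightarrow>
     0 < T \<and> smooth_curve M \<and> (\<forall>t. M (t + T) = M t) \<and>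
     (\<forall>t. velocity M t \<noteq> 0) \<and> inj_on M {0..<T}"

definition signed_curvature :: "(real \<Rightarrow> real ^ 2) \<Rightarrow> real \<Rightarrow> real" where
  "signed_curvature M t =
     (let v = velocity M t; a = velocity (velocity M) t
      in (v $ 1 * a $ 2 - v $ 2 * a $ 1) / norm v ^ 3)"

definition convex_curve :: "(real \<Rightarrow> real ^ 2) \<Rightarrow> bool" where
  "convex_curve M \<longleftrightarrow> (\<forall>t. 0 < signed_curvature M t) \<or> (\<forall>t. signed_curvature M t < 0)"

text \<open>For closed simple convex curves, the positive orientation is the one with positive
  curvature; replacing \<open>M\<close> by \<open>\<lambda>t. M (- t)\<close> reverses the orientation.\<close>

definition positively_oriented :: "(real \<Rightarrow> real ^ 2) \<Rightarrow> bool" where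
  "positively_oriented M \<longleftrightarrow> (\<forall>t. 0 < signed_curvature M t)"

definition curve_length :: "(real \<Rightarrow> real ^ 2) \<Rightarrow> real \<Rightarrow> real" where
  "curve_length M T = integral {0..T} (\<lambda>t. norm (velocity M t))"

definition average_width :: "(real \<Rightarrow> real ^ 2) \<Rightarrow> real \<Rightarrow> real" where
  "average_width M T = curve_length M T / pi"

text \<open>For a closed simple curve, the choice of the parameter of the point \<open>a\<close> is immaterial:
  any two differ by a multiple of the period.\<close>

definition tangent_vector :: "(real \<Rightarrow> real ^ 2) \<Rightarrow> real ^ 2 \<Rightarrow> real ^ 2" where
  "tangent_vector M a = velocity M (SOME t. M t = a)"

definition tangent_line :: "(real \<Rightarrow> real ^ 2) \<Rightarrow> real ^ 2 \<Rightarrow> (real ^ 2) set" where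
  "tangent_line M a = {a + s *\<^sub>R tangent_vector M a | s. True}"

definition unit_normal :: "(real \<Rightarrow> real ^ 2) \<Rightarrow> real ^ 2 \<Rightarrow> real ^ 2" where
  "unit_normal M a = (let u = sgn (tangent_vector M a) in vector [- (u $ 2), u $ 1])"

definition parallel_pair :: "(real \<Rightarrow> real ^ 2) \<Rightarrow> real ^ 2 \<Rightarrow> real ^ 2 \<Rightarrow> bool" where
  "parallel_pair M a b \<longleftrightarrow>
     a \<in> range M \<and> b \<in> range M \<and> a \<noteq> b \<and> affine_parallel (tangent_line M a) (tangent_line M b)"

definition constant_width :: "(real \<Rightarrow> real ^ 2) \<Rightarrow> bool" where
  "constant_width M \<longleftrightarrow>
     (\<exists>w. \<forall>a b. parallel_pair M a b \<longrightarrow> setdist (tangent_line M a) (tangent_line M b) = w)"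

definition wigner_caustic :: "(real \<Rightarrow> real ^ 2) \<Rightarrow> (real ^ 2) set" where
  "wigner_caustic M = {(1 / 2) *\<^sub>R (a + b) | a b. parallel_pair M a b}"

definition CWMS :: "(real \<Rightarrow> real ^ 2) \<Rightarrow> real \<Rightarrow> (real ^ 2) set" where
  "CWMS M T = {a - b + average_width M T *\<^sub>R unit_normal M a | a b. parallel_pair M a b}"

definition SMS :: "(real \<Rightarrow> real ^ 2) \<Rightarrow> real \<Rightarrow> (real ^ 2) set" where
  "SMS M T = {a + (curve_length M T / (2 * pi)) *\<^sub>R unit_normal M a | a. a \<in> range M}"

definition support_function :: "(real \<Rightarrow> real ^ 2) \<Rightarrow> real \<Rightarrow> real" where
  "support_function M \<theta> = (SUP a\<in>range M. a \<bullet> vector [cos \<theta>, sin \<theta>])"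

definition support_param :: "(real \<Rightarrow> real ^ 2) \<Rightarrow> real \<Rightarrow> real ^ 2" where
  "support_param M \<theta> =
     (let p = support_function M; p' = deriv p
      in vector [p \<theta> * cos \<theta> - p' \<theta> * sin \<theta>, p \<theta> * sin \<theta> + p' \<theta> * cos \<theta>])"

definition wigner_caustic_param :: "(real \<Rightarrow> real ^ 2) \<Rightarrow> real \<Rightarrow> real ^ 2" where
  "wigner_caustic_param M \<theta> = (1 / 2) *\<^sub>R (support_param M \<theta> + support_param M (\<theta> + pi))"

definition CWMS_param :: "(real \<Rightarrow> real ^ 2) \<Rightarrow> real \<Rightarrow> real \<Rightarrow> real ^ 2" where
  "CWMS_param M T \<theta> =
     support_param M \<theta> - support_param M (\<theta> + pi)
       + average_width M T *\<^sub>R unit_normal M (support_param M \<theta>)"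

definition SMS_param :: "(real \<Rightarrow> real ^ 2) \<Rightarrow> real \<Rightarrow> real \<Rightarrow> real ^ 2" where
  "SMS_param M T \<theta> =
     support_param M \<theta> + (curve_length M T / (2 * pi)) *\<^sub>R unit_normal M (support_param M \<theta>)"

definition oriented_area :: "(real \<Rightarrow> real ^ 2) \<Rightarrow> real \<Rightarrow> real \<Rightarrow> real" where
  "oriented_area C a b =
     1 / 2 * integral {a..b} (\<lambda>t. - (C t $ 2) * velocity C t $ 1 + C t $ 1 * velocity C t $ 2)"

text \<open>The parallel pairs are \<open>\<gamma>(\<theta>), \<gamma>(\<theta> + \<pi>)\<close> with \<open>\<gamma> = support_param M\<close>, so the Wigner caustic,
  which is symmetric in the two points, is traversed once for \<open>\<theta> \<in> [0, \<pi>]\<close>.\<close>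

definition wigner_caustic_area :: "(real \<Rightarrow> real ^ 2) \<Rightarrow> real" where
  "wigner_caustic_area M = oriented_area (wigner_caustic_param M) 0 pi"

definition CWMS_area :: "(real \<Rightarrow> real ^ 2) \<Rightarrow> real \<Rightarrow> real" where
  "CWMS_area M T = oriented_area (CWMS_param M T) 0 (2 * pi)"

definition SMS_area :: "(real \<Rightarrow> real ^ 2) \<Rightarrow> real \<Rightarrow> real" where
  "SMS_area M T = oriented_area (SMS_param M T) 0 (2 * pi)"

end

theory Submission
  imports Defs
begin

text \<open>
  Write $u(\theta) = (\cos\theta, \sin\theta)$ and let $p$ be the support function of $M$. A curve
  $q u + q' u'$ with "support function" $q$ has velocity $(q + q'') u'$, so its oriented area is
  $\frac12\int q (q + q'')$, a quadratic form in $q$. All three sets of the theorem are of this kind.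
  With $m = L_M / 2\pi$, which is the mean value of $p$, the SMS has $q = p - m$. Split this function
  into its antisymmetric part $o$ and its symmetric part $e$ under the half turn
  $\theta \mapsto \theta + \pi$. As $u(\theta + \pi) = -u(\theta)$, the Wigner caustic has the
  support function $o$, traversed over half a period only, and the CWMS has the support function
  $2 e$. In the area of the SMS the mixed terms change sign under the half turn and integrate to
  zero, so over the full period the area of $o + e$ is the sum of the areas of $o$ and of $e$.

  Absolute values may be taken because both areas have the same sign: $o$ and $e$ have mean value
  zero, and for such a function $\int q (q + q'') = \int q^2 - \int q'^2 \le 0$ by Wirtinger's
  inequality (\<open>abs_support_area_split\<close>).
  If $M$ has constant width, then $\gamma(\theta) - \gamma(\theta + \pi) = 2 m\, u(\theta)$, which
  gives the two equalities of sets at once (\<open>constant_width_sets\<close>).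

  What must be proved about $M$ itself is that it has a parametrization $\gamma$ by the
  angle of the outer normal over exactly one turn; once it is there, every height function
  $\gamma \cdot u(\theta)$ increases towards $\theta$ from both sides within
  half a turn, hence $\gamma(\theta)$ is
  the point of support in the direction $u(\theta)$. Positive curvature makes the tangent
  angle strictly increasing, but that it grows by $2\pi$ and not by a larger multiple in one period
  depends on $M$ being simple. This is Hopf's theorem on turning tangents
  (\<open>Umlaufsatz\<close>), proved here by lifting the direction of the secants.
\<close>

section \<open>Periodic functions of a real variable\<close>

lemma periodic_of_int:
  fixes f :: "real \<Rightarrow> 'a"
  assumes "\<And>t. f (t + T) = f t"
  shows "f (t + of_int k * T) = f t"
proof -
  interpret periodic_fun_simple f T by unfold_locales (rule assms)
  show ?thesis by (rule plus_of_int)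
qed

lemma periodic_derivative:
  fixes f :: "real \<Rightarrow> 'a::real_normed_vector"
  assumes f: "\<And>t. (f has_vector_derivative f' t) (at t)" and per: "\<And>t. f (t + T) = f t"
  shows "f' (t + T) = f' t"
proof -
  have "((\<lambda>t. t + T) has_vector_derivative 1) (at t)"
    by (auto simp flip: has_real_derivative_iff_has_vector_derivative intro!: derivative_eq_intros)
  from vector_diff_chain_at[OF this f] have "(f has_vector_derivative f' (t + T)) (at t)"
    by (simp add: o_def per)
  then show ?thesis using vector_derivative_unique_at[OF _ f] by blast
qed

lemma reduce_mod_period:
  fixes T t :: real
  assumes "0 < T"
  obtains k :: int where "t + of_int k * T \<in> {a..<a + T}"
proof
  have "of_int \<lfloor>(t - a) / T\<rfloor> \<le> (t - a) / T" "(t - a) / T < of_int \<lfloor>(t - a) / T\<rfloor> + 1"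
    by linarith+
  then have "of_int \<lfloor>(t - a) / T\<rfloor> * T \<le> t - a" "t - a < (of_int \<lfloor>(t - a) / T\<rfloor> + 1) * T"
    using assms by (simp_all only: pos_le_divide_eq pos_divide_less_eq)
  then show "t + of_int (- \<lfloor>(t - a) / T\<rfloor>) * T \<in> {a..<a + T}"
    by (simp add: algebra_simps)
qed

lemma periodic_inj_on_imp_eq_mod:
  fixes f :: "real \<Rightarrow> 'a"
  assumes per: "\<And>t. f (t + T) = f t" and inj: "inj_on f {0..<T}" and T: "0 < T" and eq: "f a = f b"
  obtains k :: int where "b = a + of_int k * T"
proof -
  obtain i :: int where i: "a + of_int i * T \<in> {0..<T}"
    using reduce_mod_period[OF T, of a 0] by auto
  obtain j :: int where j: "b + of_int j * T \<in> {0..<T}"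
    using reduce_mod_period[OF T, of b 0] by auto
  have "f (a + of_int i * T) = f (b + of_int j * T)"
    using eq by (simp add: periodic_of_int[of f, OF per])
  with inj_onD[OF inj _ i j] have "b = a + of_int (i - j) * T"
    by (simp add: algebra_simps)
  then show thesis by (rule that)
qed

lemma global_antiderivative:
  fixes f :: "real \<Rightarrow> real"
  assumes "continuous_on UNIV f"
  obtains F where "\<And>x. (F has_real_derivative f x) (at x)"
proof -
  have "\<exists>F. \<forall>x::real. -\<infinity> < ereal x \<longrightarrow> ereal x < \<infinity> \<longrightarrow> (F has_vector_derivative f x) (at x)"
    by (rule einterval_antiderivative)
      (use assms in \<open>auto simp: continuous_on_eq_continuous_at\<close>)
  then show ?thesis
    using that by (auto simp: has_real_derivative_iff_has_vector_derivative)
qed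

lemma integral_of_derivative:
  fixes F f :: "real \<Rightarrow> real"
  assumes "\<And>x. (F has_real_derivative f x) (at x)" "a \<le> b"
  shows "integral {a..b} f = F b - F a"
proof (rule integral_unique, rule fundamental_theorem_of_calculus[OF assms(2)])
  fix x show "(F has_vector_derivative f x) (at x within {a..b})"
    using assms(1)[of x] has_vector_derivative_at_within
    by (auto simp: has_real_derivative_iff_has_vector_derivative)
qed

text \<open>
  The increment over one period of an antiderivative of a periodic function does not depend on
  the starting point, since its derivative vanishes.
\<close>

lemma shifted_derivative_const_diff:
  fixes F f :: "real \<Rightarrow> real"
  assumes F: "\<And>x. (F has_real_derivative f x) (at x)" and per: "\<And>x. f (x + T) = f x"
  shows "F (a + T) - F a = F (b + T) - F b"
proof -
  have "((\<lambda>x. F (x + T) - F x) has_real_derivative 0) (at x)" for x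
    using DERIV_diff[OF DERIV_shift[THEN iffD1, OF F[of "x + T"]] F[of x]] by (simp add: per)
  then show ?thesis
    using DERIV_isconst_all[of "\<lambda>x. F (x + T) - F x" a b] by simp
qed

lemma integral_period_shift:
  fixes f :: "real \<Rightarrow> real"
  assumes "continuous_on UNIV f" "\<And>x. f (x + T) = f x" "0 \<le> T"
  shows "integral {a..a+T} f = integral {b..b+T} f"
proof -
  obtain F where F: "\<And>x. (F has_real_derivative f x) (at x)"
    using global_antiderivative[OF assms(1)] by blast
  show ?thesis
    using shifted_derivative_const_diff[of F f T a b, OF F assms(2)] assms(3)
    by (simp add: integral_of_derivative[OF F])
qed

text \<open>
  The factor \<open>c\<close> is meant to be a sign: for \<open>c = -1\<close> the two halves of the integral cancel, for
  \<open>c = 1\<close> they are equal.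
\<close>

lemma integral_half_periods:
  fixes f :: "real \<Rightarrow> real"
  assumes cont: "continuous_on UNIV f" and per: "\<And>x. f (x + T) = c * f x" and T: "0 \<le> T"
  shows "integral {0..2*T} f = (1 + c) * integral {0..T} f"
proof -
  obtain F where F: "\<And>x. (F has_real_derivative f x) (at x)"
    using global_antiderivative[OF cont] by blast
  have "((\<lambda>x. F (x + T) - c * F x) has_real_derivative 0) (at x)" for x
    using DERIV_diff[OF DERIV_shift[THEN iffD1, OF F[of "x + T"]] DERIV_cmult[OF F[of x], of c]]
    by (simp add: per)
  then have "F (T + T) - c * F T = F (0 + T) - c * F 0"
    using DERIV_isconst_all[of "\<lambda>x. F (x + T) - c * F x" T 0] by blast
  then show ?thesis
    using T by (simp add: integral_of_derivative[OF F] ring_distribs)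
qed

lemma integral_shift_argument:
  fixes f :: "real \<Rightarrow> real"
  assumes cont: "continuous_on UNIV f" and ab: "a \<le> b"
  shows "integral {a..b} (\<lambda>x. f (x + c)) = integral {a + c..b + c} f"
proof -
  obtain F where F: "\<And>x. (F has_real_derivative f x) (at x)"
    using global_antiderivative[OF cont] by blast
  have "((\<lambda>x. F (x + c)) has_real_derivative f (x + c)) (at x)" for x
    by (rule DERIV_shift[THEN iffD1, OF F])
  from integral_of_derivative[OF this ab] integral_of_derivative[OF F, of "a + c" "b + c"] ab
  show ?thesis by simp
qed

section \<open>Wirtinger's inequality\<close>

text \<open>
  For \<open>k = 1\<close> this rests on the identity of \<open>f'\<^sup>2 - f\<^sup>2 - (f' - f cot (x - a))\<^sup>2\<close> with the derivative of
  \<open>f\<^sup>2 cot (x - a)\<close>, which is singular at both ends. For \<open>k < 1\<close> the argument of the cotangent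
  can be kept inside \<open>(0, \<pi>)\<close>, so no boundary limits are needed; the limit \<open>k \<rightarrow> 1\<close> is then harmless.
\<close>

lemma integral_Dirichlet_le_scaled:
  fixes f f' :: "real \<Rightarrow> real"
  assumes f: "\<And>x. (f has_real_derivative f' x) (at x)" and cont: "continuous_on UNIV f'"
    and zero: "f a = 0" "f (a + pi) = 0" and k: "0 < k" "k < 1"
  shows "k\<^sup>2 * integral {a..a+pi} (\<lambda>x. (f x)\<^sup>2) \<le> integral {a..a+pi} (\<lambda>x. (f' x)\<^sup>2)"
proof -
  \<comment> \<open>\<open>u\<close> maps \<open>{a..a+pi}\<close> onto the interval of length \<open>k * pi\<close> centred at \<open>pi / 2\<close>.\<close>
  define u where "u = (\<lambda>x. k * (x - a) + (1 - k) * pi / 2)"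
  have u: "sin (u x) \<noteq> 0" if "x \<in> {a..a+pi}" for x
  proof -
    have "0 < u x"
      using that k by (auto simp: u_def intro!: add_nonneg_pos)
    have "k * (x - a) \<le> k * pi" using that k by auto
    moreover have "u x = k * (x - a) - k * pi + (pi - (1 - k) * pi / 2)"
      by (simp add: u_def field_simps)
    moreover have "0 < (1 - k) * pi" using k by simp
    ultimately have "u x < pi" by linarith
    with \<open>0 < u x\<close> show ?thesis using sin_gt_zero[of "u x"] by simp
  qed
  have contf: "continuous_on S f" for S
    using f by (meson DERIV_continuous continuous_at_imp_continuous_on)
  have contf': "continuous_on S f'" for S
    using cont continuous_on_subset by blast
  define G where "G = (\<lambda>x. (f' x)\<^sup>2 - k\<^sup>2 * (f x)\<^sup>2 - (f' x - k * f x * cot (u x))\<^sup>2)"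
  have "((\<lambda>x. k * (f x)\<^sup>2 * cot (u x)) has_real_derivative G x) (at x within {a..a+pi})"
    if "x \<in> {a..a+pi}" for x
  proof -
    have "((\<lambda>x. k * (f x)\<^sup>2 * cot (u x)) has_real_derivative
       (k * (2 * f x * f' x) * cot (u x) + k * (f x)\<^sup>2 * (- inverse ((sin (u x))\<^sup>2) * k))) (at x)"
      by (rule derivative_eq_intros f refl u[OF that]
          DERIV_chain2[where f=cot and g=u, OF DERIV_cot[OF u[OF that]]] | simp add: u_def algebra_simps power2_eq_square)+
    also have "k * (2 * f x * f' x) * cot (u x) + k * (f x)\<^sup>2 * (- inverse ((sin (u x))\<^sup>2) * k) = G x"
    proof -
      have "1 + (cot (u x))\<^sup>2 = ((sin (u x))\<^sup>2 + (cos (u x))\<^sup>2) / (sin (u x))\<^sup>2"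
        using u[OF that] unfolding cot_def power_divide add_divide_distrib by simp
      then have i: "inverse ((sin (u x))\<^sup>2) = 1 + (cot (u x))\<^sup>2"
        by (simp add: divide_inverse)
      show ?thesis
        unfolding G_def i by (simp add: algebra_simps power2_eq_square)
    qed
    finally show ?thesis
      by (rule has_field_derivative_at_within)
  qed
  then have "(G has_integral (k * (f (a+pi))\<^sup>2 * cot (u (a+pi)) - k * (f a)\<^sup>2 * cot (u a))) {a..a+pi}"
    by (intro fundamental_theorem_of_calculus)
      (auto simp: has_real_derivative_iff_has_vector_derivative)
  then have G: "(G has_integral 0) {a..a+pi}"
    by (simp add: zero)
  have "((\<lambda>x. (f' x)\<^sup>2 - k\<^sup>2 * (f x)\<^sup>2) has_integral
     (integral {a..a+pi} (\<lambda>x. (f' x)\<^sup>2) - k\<^sup>2 * integral {a..a+pi} (\<lambda>x. (f x)\<^sup>2))) {a..a+pi}"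
    by (intro has_integral_diff has_integral_mult_right integrable_integral integrable_continuous_real
        continuous_intros contf contf')
  from has_integral_le[OF G this]
  show ?thesis by (simp add: G_def)
qed

lemma integral_Dirichlet_le:
  fixes f f' :: "real \<Rightarrow> real"
  assumes f: "\<And>x. (f has_real_derivative f' x) (at x)" and cont: "continuous_on UNIV f'"
    and zero: "f a = 0" "f (a + pi) = 0"
  shows "integral {a..a+pi} (\<lambda>x. (f x)\<^sup>2) \<le> integral {a..a+pi} (\<lambda>x. (f' x)\<^sup>2)"
proof (rule tendsto_upperbound)
  show "((\<lambda>k. k\<^sup>2 * integral {a..a+pi} (\<lambda>x. (f x)\<^sup>2)) \<longlongrightarrow> integral {a..a+pi} (\<lambda>x. (f x)\<^sup>2)) (at_left 1)"
    by (auto intro!: tendsto_eq_intros)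
  show "\<forall>\<^sub>F k in at_left 1. k\<^sup>2 * integral {a..a+pi} (\<lambda>x. (f x)\<^sup>2) \<le> integral {a..a+pi} (\<lambda>x. (f' x)\<^sup>2)"
    unfolding eventually_at_left_field
    by (rule exI[of _ 0]) (auto intro!: integral_Dirichlet_le_scaled[OF assms])
qed simp

text \<open>
  The difference \<open>f x - f (x + pi)\<close> changes sign under the half turn, so it has a zero \<open>a\<close>. With
  \<open>c = f a\<close>, the function \<open>f - c\<close> vanishes at \<open>a\<close>, \<open>a + pi\<close> and \<open>a + 2 pi\<close>, and the inequality with
  Dirichlet boundary values applies to both halves of the period. Because \<open>f\<close> has mean value zero,
  subtracting the constant only increases the integral of the square.
\<close>

lemma Wirtinger_inequality:
  fixes f f' :: "real \<Rightarrow> real"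
  assumes f: "\<And>x. (f has_real_derivative f' x) (at x)" and cont: "continuous_on UNIV f'"
    and per: "\<And>x. f (x + 2 * pi) = f x" and mean: "integral {0..2*pi} f = 0"
  shows "integral {0..2*pi} (\<lambda>x. (f x)\<^sup>2) \<le> integral {0..2*pi} (\<lambda>x. (f' x)\<^sup>2)"
proof -
  have contf: "continuous_on S f" for S
    using f by (meson DERIV_continuous continuous_at_imp_continuous_on)
  have contf': "continuous_on S f'" for S
    using cont continuous_on_subset by blast
  have per': "f' (x + 2 * pi) = f' x" for x
    using periodic_derivative[of f f' "2 * pi"] f per
    by (simp add: has_real_derivative_iff_has_vector_derivative)
  have "\<exists>a. f a - f (a + pi) = 0"
  proof -
    define g where "g = (\<lambda>x. f x - f (x + pi))"
    have g: "g pi = - g 0" using per[of 0] by (simp add: g_def)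
    have "continuous_on {0..pi} g"
      unfolding g_def
      by (rule continuous_on_diff[OF contf continuous_on_compose2[OF contf[of UNIV]]])
        (auto intro!: continuous_intros)
    then have "\<exists>x\<ge>0. x \<le> pi \<and> g x = 0"
      using IVT'[of g 0 0 pi] IVT2'[of g pi 0 0] g
      by (cases "g 0 \<le> 0") simp_all
    then show ?thesis unfolding g_def by blast
  qed
  then obtain a where a: "f (a + pi) = f a"
    by (metis eq_iff_diff_eq_0)
  define c where "c = f a"
  define h where "h = (\<lambda>x. f x - c)"
  have h: "(h has_real_derivative f' x) (at x)" for x
    unfolding h_def by (rule derivative_eq_intros f refl | simp)+
  have conth: "continuous_on S h" for S
    unfolding h_def by (intro continuous_intros contf)
  have pi2: "a + 2 * pi = a + pi + pi" by simp
  have a2: "f (a + pi + pi) = f a" using per[of a] by (simp only: pi2)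
  have hz: "h a = 0" "h (a + pi) = 0" "h (a + pi + pi) = 0"
    unfolding h_def c_def a a2 by (rule diff_self)+
  have int1: "(\<lambda>x. (h x)\<^sup>2) integrable_on {p..q}" for p q
    by (intro integrable_continuous_real continuous_intros conth)
  have int2: "(\<lambda>x. (f' x)\<^sup>2) integrable_on {p..q}" for p q
    by (intro integrable_continuous_real continuous_intros contf')
  have "integral {0..2*pi} (\<lambda>x. (f x)\<^sup>2) + 2 * pi * c\<^sup>2 = integral {0..2*pi} (\<lambda>x. (h x)\<^sup>2)"
  proof -
    have "integral {0..2*pi} (\<lambda>x. (h x)\<^sup>2) = integral {0..2*pi} (\<lambda>x. (f x)\<^sup>2 - 2 * c * f x + c\<^sup>2)"
      by (intro integral_cong) (simp add: h_def power2_eq_square algebra_simps)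
    also have "((\<lambda>x. (f x)\<^sup>2 - 2 * c * f x + c\<^sup>2) has_integral
        (integral {0..2*pi} (\<lambda>x. (f x)\<^sup>2) - 2 * c * integral {0..2*pi} f + 2*pi * c\<^sup>2)) {0..2*pi}"
      using has_integral_const_real[of "c\<^sup>2" 0 "2*pi"]
      by (intro has_integral_add has_integral_diff has_integral_mult_right integrable_integral
          integrable_continuous_real continuous_on_power contf) simp
    then have "integral {0..2*pi} (\<lambda>x. (f x)\<^sup>2 - 2 * c * f x + c\<^sup>2) =
       integral {0..2*pi} (\<lambda>x. (f x)\<^sup>2) + 2 * pi * c\<^sup>2"
      by (simp add: mean integral_unique)
    finally show ?thesis by simp
  qed
  also have "integral {0..2*pi} (\<lambda>x. (h x)\<^sup>2) = integral {a..a+2*pi} (\<lambda>x. (h x)\<^sup>2)"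
    using integral_period_shift[of "\<lambda>x. (h x)\<^sup>2" "2*pi" 0 a, OF continuous_on_power[OF conth]]
    by (simp add: h_def per)
  also have "\<dots> = integral {a..a+pi} (\<lambda>x. (h x)\<^sup>2) + integral {a+pi..a+pi+pi} (\<lambda>x. (h x)\<^sup>2)"
    using Henstock_Kurzweil_Integration.integral_combine[of a "a+pi" "a+2*pi", OF _ _ int1] unfolding pi2 by simp
  also have "\<dots> \<le> integral {a..a+pi} (\<lambda>x. (f' x)\<^sup>2) + integral {a+pi..a+pi+pi} (\<lambda>x. (f' x)\<^sup>2)"
    by (intro add_mono integral_Dirichlet_le h cont hz)
  also have "\<dots> = integral {a..a+2*pi} (\<lambda>x. (f' x)\<^sup>2)"
    using Henstock_Kurzweil_Integration.integral_combine[of a "a+pi" "a+2*pi", OF _ _ int2] unfolding pi2 by simp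
  also have "\<dots> = integral {0..2*pi} (\<lambda>x. (f' x)\<^sup>2)"
    using integral_period_shift[of "\<lambda>x. (f' x)\<^sup>2" "2*pi" 0 a, OF continuous_on_power[OF contf']]
    by (simp add: per')
  finally have *: "integral {0..2*pi} (\<lambda>x. (f x)\<^sup>2) + 2 * pi * c\<^sup>2 \<le> integral {0..2*pi} (\<lambda>x. (f' x)\<^sup>2)" .
  show ?thesis
  proof -
    have "0 \<le> 2 * pi * c\<^sup>2" by simp
    with * show ?thesis by linarith
  qed
qed

section \<open>Rotation index of a simple closed curve\<close>

text \<open>
  Two real numbers with the same image under \<open>cis\<close> are equal or at least \<open>2 pi\<close> apart, so
  \<open>f\<close> is continuous with a discrete range.
\<close>

lemma cis_fixed_imp_constant_on:
  fixes f :: "'a::topological_space \<Rightarrow> real"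
  assumes "connected S" "continuous_on S f" and cis: "\<And>x. x \<in> S \<Longrightarrow> cis (f x) = w"
    and xy: "x \<in> S" "y \<in> S"
  shows "f x = f y"
proof -
  have "f constant_on S"
  proof (rule continuous_discrete_range_constant[OF assms(1,2)])
    fix x assume x: "x \<in> S"
    have "2 * pi \<le> \<bar>f y - f x\<bar>" if y: "y \<in> S" "f y \<noteq> f x" for y
    proof -
      have "cos (f y) = cos (f x)" "sin (f y) = sin (f x)"
        using cis[OF x] cis[OF y(1)] by (auto simp: complex_eq_iff)
      then have "cos (f y - f x) = 1"
        using sin_cos_squared_add[of "f x"] by (simp add: cos_diff power2_eq_square)
      then obtain n :: int where n: "f y - f x = n * 2 * pi"
        using cos_one_2pi_int[of "f y - f x"] by auto
      with y have "1 \<le> \<bar>of_int n :: real\<bar>"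
        by (cases "n = 0") (auto simp flip: of_int_abs)
      with n show ?thesis
        using mult_right_mono[of 1 "\<bar>of_int n :: real\<bar>" "2 * pi"] by (simp add: abs_mult)
    qed
    then show "\<exists>e>0. \<forall>y. y \<in> S \<and> f y \<noteq> f x \<longrightarrow> e \<le> norm (f y - f x)"
      by (intro exI[of _ "2 * pi"]) auto
  qed
  then show ?thesis using xy by (auto simp: constant_on_def)
qed

text \<open>
  A continuous angle of a direction that stays in the closed upper half plane cannot leave
  \<open>[0, pi]\<close>: immediately beyond either end the sine is negative.
\<close>

lemma angle_stays_in_upper_half:
  fixes f :: "real \<Rightarrow> real"
  assumes cont: "continuous_on {0..b} f" and sin: "\<And>x. x \<in> {0..b} \<Longrightarrow> 0 \<le> sin (f x)"
    and b: "0 \<le> b" and f0: "f 0 = 0"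
  shows "f b \<in> {0..pi}"
proof (rule ccontr)
  assume "f b \<notin> {0..pi}"
  then consider "f b > pi" | "f b < 0" by fastforce
  then show False
  proof cases
    case 1
    define y where "y = min (f b) (3 / 2 * pi)"
    have y: "pi < y" "y < 2 * pi" "y \<le> f b" using 1 by (auto simp: y_def min_def)
    then obtain x where "x \<in> {0..b}" "f x = y"
      using IVT'[of f 0 y b] cont b f0 by auto
    then show False using sin[of x] sin_lt_zero[OF y(1,2)] by simp
  next
    case 2
    define y where "y = max (f b) (- pi / 2)"
    have y: "- pi < y" "y < 0" "f b \<le> y" using 2 by (auto simp: y_def max_def)
    then obtain x where "x \<in> {0..b}" "f x = y"
      using IVT2'[of f b y 0] cont b f0 by auto
    then show False using sin[of x] sin_gt_zero[of "-y"] y by simp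
  qed
qed

text \<open>
  The difference quotient extends continuously to coinciding points: it is the mean of the
  derivative over the interval, \<open>Q (s, d) = \<integral> z' (s + u d) du\<close> for \<open>u\<close> in \<open>[0, 1]\<close>.
\<close>

lemma secant_mean_derivative:
  fixes z z' :: "real \<Rightarrow> complex"
  assumes z: "\<And>t. (z has_vector_derivative z' t) (at t)" and cont: "continuous_on UNIV z'"
  obtains Q where "continuous_on UNIV Q" "\<And>s. Q (s, 0) = z' s"
    "\<And>s d. d *\<^sub>R Q (s, d) = z (s + d) - z s"
proof
  define Q where "Q = (\<lambda>p. integral (cbox 0 1) (\<lambda>u. z' (fst p + u * snd p)))"
  show "continuous_on UNIV Q"
    unfolding Q_def
  proof (rule integral_continuous_on_param)
    have "continuous_on (UNIV \<times> cbox 0 1) (\<lambda>x. fst (fst x) + snd x * snd (fst x :: real \<times> real))"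
      by (intro continuous_intros)
    from continuous_on_compose2[OF cont this]
    show "continuous_on (UNIV \<times> cbox 0 1) (\<lambda>(p, u). z' (fst p + u * snd p))"
      by (simp add: split_beta)
  qed
  show "Q (s, 0) = z' s" for s
    by (simp add: Q_def)
  show "d *\<^sub>R Q (s, d) = z (s + d) - z s" for s d
  proof -
    have "((\<lambda>u. s + u * d) has_vector_derivative d) (at u)" for u
      by (auto simp flip: has_real_derivative_iff_has_vector_derivative intro!: derivative_eq_intros)
    from vector_diff_chain_at[OF this z]
    have "((\<lambda>u. z (s + u * d)) has_vector_derivative d *\<^sub>R z' (s + u * d)) (at u within {0..1})" for u
      by (simp add: o_def has_vector_derivative_at_within)
    then have "((\<lambda>u. d *\<^sub>R z' (s + u * d)) has_integral (z (s + 1 * d) - z (s + 0 * d))) {0..1}"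
      by (intro fundamental_theorem_of_calculus) auto
    then show ?thesis
      by (simp add: Q_def integral_unique flip: integral_cmul)
  qed
qed

text \<open>
  Hopf's argument. The secant slopes \<open>Q (s, d)\<close> have no zeros for \<open>0 \<le> d \<le> T/2\<close> as the
  curve is simple, and the strip of these \<open>(s, d)\<close> is contractible, hence there is a continuous angle
  \<open>\<theta> s d\<close>; on the edge \<open>d = 0\<close> it is a tangent angle. Moving the base point of a secant of parameter
  length \<open>T/2\<close> by \<open>T/2\<close> interchanges its end points, so on the other edge the angle grows by a constant
  \<open>c\<close>, an odd multiple of \<open>pi\<close>, and by \<open>2 c\<close> over one period. For each \<open>d\<close> the
  growth over one period is a multiple of \<open>2 pi\<close>; depending continuously on \<open>d\<close>, it is \<open>2 c\<close> on the
  edge \<open>d = 0\<close> as well.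

  To determine \<open>c\<close>, consider a lowest point \<open>s0\<close>, where the tangent is horizontal. Secants that
  start at \<open>s0\<close> point upwards and secants that end there point downwards. Following both
  families from \<open>d = 0\<close> to \<open>d = T/2\<close>, each angle changes by at most \<open>pi\<close> and the changes have
  opposite signs. Their difference is \<open>c\<close>, so \<open>\<bar>c\<bar> \<le> 2 pi\<close>, and the
  odd multiple of \<open>pi\<close> can only be \<open>pi\<close> or \<open>- pi\<close>.
\<close>

theorem Umlaufsatz:
  fixes z z' :: "real \<Rightarrow> complex"
  assumes z: "\<And>t. (z has_vector_derivative z' t) (at t)" and cont: "continuous_on UNIV z'"
    and nz: "\<And>t. z' t \<noteq> 0" and T: "0 < T" and per: "\<And>t. z (t + T) = z t"
    and inj: "inj_on z {0..<T}"
  obtains \<phi> c where "continuous_on UNIV \<phi>" "\<And>t. z' t = cmod (z' t) * cis (\<phi> t)"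
    "\<And>t. \<phi> (t + T) = \<phi> t + 2 * c" "c = pi \<or> c = - pi"
proof -
  obtain Q where contQ: "continuous_on UNIV Q" and Q0: "\<And>s. Q (s, 0) = z' s"
    and Qd: "\<And>s d. d *\<^sub>R Q (s, d) = z (s + d) - z s"
    using secant_mean_derivative[OF z cont] by blast
  define S where "S = (UNIV :: real set) \<times> {0..T/2}"
  have Qnz: "Q p \<noteq> 0" if p: "p \<in> S" for p
  proof -
    obtain s d where sd: "p = (s, d)" by fastforce
    show ?thesis
    proof (cases "d = 0")
      case False
      with p sd have d: "0 < d" "d < T" using T by (auto simp: S_def)
      have "z (s + d) \<noteq> z s"
      proof
        assume "z (s + d) = z s"
        then obtain k :: int where k: "s + d = s + of_int k * T"
          using periodic_inj_on_imp_eq_mod[of z T, OF per inj T, of s "s + d"] by auto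
        with d T have "0 < (of_int k :: real)" "of_int k * T < 1 * T"
          by (auto simp: zero_less_mult_iff)
        then show False using T by (simp add: mult_less_cancel_right)
      qed
      with Qd[of d s] show ?thesis by (auto simp: sd)
    qed (simp add: sd Q0 nz)
  qed
  have "contractible S"
    unfolding S_def by (intro convex_imp_contractible convex_Times) auto
  then obtain g where contg: "continuous_on S g" and g: "\<And>p. p \<in> S \<Longrightarrow> Q p = exp (g p)"
    using continuous_logarithm_on_contractible[OF continuous_on_subset[OF contQ subset_UNIV] _ Qnz]
    by blast
  define \<theta> where "\<theta> = (\<lambda>s d. Im (g (s, d)))"
  have sgnQ: "sgn (Q (s, d)) = cis (\<theta> s d)" if "d \<in> {0..T/2}" for s d
    using g[of "(s, d)"] that by (simp add: S_def \<theta>_def sgn_eq exp_eq_polar norm_mult)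
  then have polar: "Q (s, d) = cmod (Q (s, d)) * cis (\<theta> s d)" if "d \<in> {0..T/2}" for s d
    using that by (simp flip: sgnQ add: sgn_eq)
  have cont\<theta>: "continuous_on A (\<lambda>x. \<theta> (f x) (h x))"
    if "continuous_on A f" "continuous_on A h" "h \<in> A \<rightarrow> {0..T/2}" for f h and A :: "real set"
    unfolding \<theta>_def
    by (intro continuous_intros continuous_on_compose2[OF contg] that)
      (use that(3) in \<open>auto simp: S_def\<close>)
  have cis_diff: "cis (\<theta> s d - \<theta> s' d') = sgn (Q (s, d) / Q (s', d'))"
    if "d \<in> {0..T/2}" "d' \<in> {0..T/2}" for s d s' d'
    using that by (simp add: sgn_divide sgnQ cis_divide)
  have Qsd_nz: "Q (s, d) \<noteq> 0" if "d \<in> {0..T/2}" for s d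
    using Qnz that by (simp add: S_def)
  have half: "T/2 \<in> {0..T/2}" "0 \<in> {0..T/2}" using T by auto
  \<comment> \<open>The secants at \<open>s\<close> and \<open>s + T/2\<close> join the same two points in opposite order.\<close>
  have antipodal: "Q (s + T/2, T/2) = - Q (s, T/2)" for s
  proof -
    have "(T/2) *\<^sub>R Q (s + T/2, T/2) = (T/2) *\<^sub>R (- Q (s, T/2))"
      using Qd[of "T/2" "s + T/2"] Qd[of "T/2" s] per[of s]
      by (simp add: add.assoc)
    then show ?thesis using T by (simp only: scaleR_cancel_left) auto
  qed
  have Qper: "Q (s + T, d) = Q (s, d)" if "d \<in> {0..T/2}" for s d
  proof (cases "d = 0")
    case True
    then show ?thesis by (simp add: Q0 periodic_derivative[OF z per])
  next
    case False
    have "d *\<^sub>R Q (s + T, d) = d *\<^sub>R Q (s, d)"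
      using Qd[of d "s + T"] Qd[of d s] per[of s] per[of "s + d"] by (simp add: ac_simps)
    then show ?thesis using False by simp
  qed
  define c where "c = \<theta> (0 + T/2) (T/2) - \<theta> 0 (T/2)"
  have cis_half: "cis (\<theta> (s + T/2) (T/2) - \<theta> s (T/2)) = -1" for s
    using cis_diff[OF half(1,1), of "s + T/2" s] Qsd_nz[OF half(1), of s]
    by (simp add: antipodal)
  have c: "\<theta> (s + T/2) (T/2) - \<theta> s (T/2) = c" for s
    unfolding c_def
    by (rule cis_fixed_imp_constant_on[where f = "\<lambda>s. \<theta> (s + T/2) (T/2) - \<theta> s (T/2)"
        and S = UNIV, OF connected_UNIV _ cis_half])
      (use half in \<open>simp_all add: continuous_on_diff cont\<theta> continuous_on_add continuous_on_id\<close>)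
  have cis_c: "cis c = -1"
    unfolding c_def by (rule cis_half)
  have period: "\<theta> (s + T) 0 - \<theta> s 0 = 2 * c" for s
  proof -
    have "\<theta> (s + T) 0 - \<theta> s 0 = \<theta> (s + T) (T/2) - \<theta> s (T/2)"
    proof (rule cis_fixed_imp_constant_on[where f = "\<lambda>d. \<theta> (s + T) d - \<theta> s d" and S = "{0..T/2}"])
      show "continuous_on {0..T/2} (\<lambda>d. \<theta> (s + T) d - \<theta> s d)"
        by (intro continuous_on_diff cont\<theta> continuous_intros) auto
      show "cis (\<theta> (s + T) d - \<theta> s d) = 1" if "d \<in> {0..T/2}" for d
        using cis_diff[OF that that, of "s + T" s] Qsd_nz[OF that, of s]
        by (simp add: Qper[OF that])
    qed (use T in auto)
    also have "\<dots> = 2 * c"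
      using c[of s] c[of "s + T/2"] by (simp add: add.assoc)
    finally show ?thesis .
  qed
  obtain s0 where s0: "\<And>t. Im (z s0) \<le> Im (z t)"
  proof -
    have "continuous_on {0..T} (\<lambda>t. Im (z t))"
      using z by (intro continuous_intros continuous_at_imp_continuous_on)
        (blast intro: has_vector_derivative_continuous)
    then obtain s0 where s0: "\<forall>t\<in>{0..T}. Im (z s0) \<le> Im (z t)"
      using continuous_attains_inf[of "{0..T}" "\<lambda>t. Im (z t)"] T by auto
    have "Im (z s0) \<le> Im (z t)" for t
    proof -
      obtain k :: int where "t + of_int k * T \<in> {0..<0 + T}"
        using reduce_mod_period[OF T] by blast
      then show ?thesis
        using s0 periodic_of_int[of z, OF per] by (metis add_0 atLeastAtMost_iff atLeastLessThan_iff less_imp_le)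
    qed
    then show thesis by (rule that)
  qed
  have "((\<lambda>t. Im (z t)) has_real_derivative Im (z' s0)) (at s0)"
    using bounded_linear.has_vector_derivative[OF bounded_linear_Im z]
    by (simp add: has_real_derivative_iff_has_vector_derivative)
  then have flat: "Im (z' s0) = 0"
    by (rule DERIV_local_min[OF _ zero_less_one]) (simp add: s0)
  have sin\<theta>: "sin (\<theta> s d) = Im (Q (s, d)) / cmod (Q (s, d))" if "d \<in> {0..T/2}" for s d
    using arg_cong[OF sgnQ[OF that, of s], of Im] by (simp add: Im_sgn)
  have ImQ: "d * Im (Q (s, d)) = Im (z (s + d)) - Im (z s)" for s d
    using arg_cong[OF Qd[of d s], of Im] by simp
  have upper: "0 \<le> sin (\<theta> s0 d)" if d: "d \<in> {0..T/2}" for d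
  proof -
    have "0 \<le> Im (Q (s0, d))"
    proof (cases "d = 0")
      case False
      with d have "0 < d" by simp
      moreover have "0 \<le> d * Im (Q (s0, d))" using ImQ[of d s0] s0 by simp
      ultimately show ?thesis by (simp add: zero_le_mult_iff)
    qed (simp add: Q0 flat)
    then show ?thesis by (simp add: sin\<theta>[OF d])
  qed
  have lower: "sin (\<theta> (s0 - d) d) \<le> 0" if d: "d \<in> {0..T/2}" for d
  proof -
    have "Im (Q (s0 - d, d)) \<le> 0"
    proof (cases "d = 0")
      case False
      with d have "0 < d" by simp
      moreover have "d * Im (Q (s0 - d, d)) \<le> 0" using ImQ[of d "s0 - d"] s0 by simp
      ultimately show ?thesis by (simp add: mult_le_0_iff)
    qed (simp add: Q0 flat)
    then show ?thesis by (simp add: sin\<theta>[OF d] divide_nonpos_nonneg)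
  qed
  have "sin (\<theta> s0 0) = 0"
    using upper[OF half(2)] lower[OF half(2)] by simp
  then obtain m :: int where m: "\<theta> s0 0 = of_int m * pi"
    using sin_zero_iff_int2 by blast
  \<comment> \<open>\<open>\<alpha>\<close> and \<open>\<beta>\<close> are the changes of the angle from the tangent at \<open>s0\<close> along the secants that
    start, respectively end, at \<open>s0\<close>; the parity of \<open>m\<close> tells whether that tangent points to the
    right or to the left.\<close>
  define \<alpha> where "\<alpha> = \<theta> s0 (T/2) - of_int m * pi"
  define \<beta> where "\<beta> = \<theta> (s0 - T/2) (T/2) - of_int m * pi"
  have \<alpha>\<beta>: "\<alpha> - \<beta> = c"
    using c[of "s0 - T/2"] by (simp add: \<alpha>_def \<beta>_def)
  have sin_shift: "sin (x - of_int m * pi) = (if even m then sin x else - sin x)" for x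
    by (simp add: sin_diff mult.commute[of _ pi])
  have ca: "continuous_on {0..T/2} (\<lambda>d. \<theta> s0 d - of_int m * pi)"
    and cb: "continuous_on {0..T/2} (\<lambda>d. \<theta> (s0 - d) d - of_int m * pi)"
    by (intro continuous_on_diff cont\<theta> continuous_intros; simp)+
  have odd_angle: "x = pi" if "cos x = -1" "0 \<le> x" "x \<le> 2 * pi" for x :: real
  proof -
    have "cos (x - pi) = 1" using that by (simp add: cos_diff)
    then obtain n :: int where n: "x - pi = real_of_int n * (2 * pi)"
      unfolding cos_one_2pi_int by (auto simp: mult.assoc)
    have "real_of_int n * (2 * pi) < 1 * (2 * pi)" "- 1 * (2 * pi) < real_of_int n * (2 * pi)"
      unfolding n[symmetric] using that pi_gt_zero by linarith+
    then have "real_of_int n < 1" "- 1 < real_of_int n"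
      by (simp_all only: mult_less_cancel_right_pos zero_less_mult_iff pi_gt_zero zero_less_numeral simp_thms)
    then have "n = 0" by linarith
    then show ?thesis using n by simp
  qed
  have start: "\<theta> s0 0 - of_int m * pi = 0" "\<theta> (s0 - 0) 0 - of_int m * pi = 0"
      "- (\<theta> s0 0 - of_int m * pi) = 0" "- (\<theta> (s0 - 0) 0 - of_int m * pi) = 0"
    by (simp_all add: m)
  have "c = pi \<or> c = - pi"
  proof (cases "even m")
    case True
    have "0 \<le> sin (\<theta> s0 d - of_int m * pi)" if "d \<in> {0..T/2}" for d
      using upper[OF that] True by (simp add: sin_shift sin_minus del: minus_diff_eq)
    from angle_stays_in_upper_half[OF ca this _ start(1)]
    have a: "\<alpha> \<in> {0..pi}"
      using T unfolding \<alpha>_def by simp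
    have "0 \<le> sin (- (\<theta> (s0 - d) d - of_int m * pi))" if "d \<in> {0..T/2}" for d
      using lower[OF that] True by (simp add: sin_shift sin_minus del: minus_diff_eq)
    from angle_stays_in_upper_half[OF continuous_on_minus[OF cb] this _ start(4)]
    have b: "- \<beta> \<in> {0..pi}"
      using T unfolding \<beta>_def by simp
    have "0 \<le> c" "c \<le> 2 * pi"
      using a b \<alpha>\<beta> by auto
    then show ?thesis
      using odd_angle[of c] cis_c by (simp add: complex_eq_iff)
  next
    case False
    have "0 \<le> sin (- (\<theta> s0 d - of_int m * pi))" if "d \<in> {0..T/2}" for d
      using upper[OF that] False by (simp add: sin_shift sin_minus del: minus_diff_eq)
    from angle_stays_in_upper_half[OF continuous_on_minus[OF ca] this _ start(3)]
    have a: "- \<alpha> \<in> {0..pi}"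
      using T unfolding \<alpha>_def by simp
    have "0 \<le> sin (\<theta> (s0 - d) d - of_int m * pi)" if "d \<in> {0..T/2}" for d
      using lower[OF that] False by (simp add: sin_shift sin_minus del: minus_diff_eq)
    from angle_stays_in_upper_half[OF cb this _ start(2)]
    have b: "\<beta> \<in> {0..pi}"
      using T unfolding \<beta>_def by simp
    have "0 \<le> - c" "- c \<le> 2 * pi"
      using a b \<alpha>\<beta> by auto
    then show ?thesis
      using odd_angle[of "- c"] cis_c by (simp add: complex_eq_iff)
  qed
  moreover have "continuous_on UNIV (\<lambda>s. \<theta> s 0)"
    using T by (simp add: cont\<theta> continuous_on_id)
  moreover have "z' t = cmod (z' t) * cis (\<theta> t 0)" for t
    using polar[OF half(2), of t] by (simp add: Q0)
  ultimately show thesis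
    using that[of "\<lambda>s. \<theta> s 0" c] period by (simp add: diff_eq_eq add.commute)
qed

text \<open>
  Near \<open>t\<close> the change \<open>\<phi> s - \<phi> t\<close> is less than \<open>pi\<close> in absolute value, so it is the imaginary part
  of the principal logarithm of \<open>v s / v t\<close>, which can be differentiated.
\<close>

lemma continuous_angle_has_derivative:
  fixes v :: "real \<Rightarrow> complex"
  assumes v: "(v has_vector_derivative v') (at t)" and nz: "\<And>t. v t \<noteq> 0"
    and cont: "isCont \<phi> t" and polar: "\<And>t. v t = cmod (v t) * cis (\<phi> t)"
  shows "(\<phi> has_real_derivative Im (v' / v t)) (at t)"
proof -
  have "((\<lambda>s. v s / v t) has_vector_derivative v' / v t) (at t)"
    using has_vector_derivative_mult_left[OF v, of "1 / v t"] by simp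
  moreover have "(Ln has_field_derivative 1) (at (v t / v t))"
    using has_field_derivative_Ln[of 1] nz[of t] by simp
  ultimately have "(Ln \<circ> (\<lambda>s. v s / v t) has_vector_derivative (v' / v t) * 1) (at t)"
    by (rule field_vector_diff_chain_at)
  then have "((\<lambda>s. Im (Ln (v s / v t)) + \<phi> t) has_vector_derivative Im (v' / v t) + 0) (at t)"
    by (intro has_vector_derivative_add has_vector_derivative_const
         bounded_linear.has_vector_derivative[OF bounded_linear_Im])
      (simp add: o_def)
  then have "((\<lambda>s. Im (Ln (v s / v t)) + \<phi> t) has_real_derivative Im (v' / v t)) (at t)"
    by (simp add: has_real_derivative_iff_has_vector_derivative)
  moreover have "\<forall>\<^sub>F s in at t. Im (Ln (v s / v t)) + \<phi> t = \<phi> s"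
  proof -
    have "((\<lambda>s. dist (\<phi> s) (\<phi> t)) \<longlongrightarrow> dist (\<phi> t) (\<phi> t)) (at t)"
      using cont by (intro tendsto_intros) (simp add: isCont_def)
    then have "\<forall>\<^sub>F s in at t. dist (\<phi> s) (\<phi> t) < pi"
      by (rule order_tendstoD) simp
    then show ?thesis
    proof (rule eventually_mono)
      fix s assume s: "dist (\<phi> s) (\<phi> t) < pi"
      have "v s / v t = of_real (cmod (v s) / cmod (v t)) * cis (\<phi> s - \<phi> t)"
        using polar[of s] polar[of t] by (metis cis_divide of_real_divide times_divide_times_eq)
      also have "\<dots> = exp (of_real (ln (cmod (v s) / cmod (v t))) + \<i> * (\<phi> s - \<phi> t))"
        using nz[of s] nz[of t] by (simp add: exp_add cis_conv_exp exp_of_real)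
      finally have "Ln (v s / v t) = of_real (ln (cmod (v s) / cmod (v t))) + \<i> * (\<phi> s - \<phi> t)"
        using s by (intro Ln_unique) (auto simp: dist_real_def)
      then show "Im (Ln (v s / v t)) + \<phi> t = \<phi> s" by simp
    qed
  qed
  ultimately show ?thesis
    by (subst has_field_derivative_cong_eventually[symmetric]) (simp_all add: nz)
qed

section \<open>Areas in terms of the support function\<close>

text \<open>
  Integration by parts over the period turns the integral of \<open>q q''\<close> into minus that of \<open>q'\<^sup>2\<close>; the
  claim is then Wirtinger's inequality.
\<close>

lemma integral_support_area_nonpos:
  fixes q q1 q2 :: "real \<Rightarrow> real"
  assumes q: "\<And>x. (q has_real_derivative q1 x) (at x)" and q1: "\<And>x. (q1 has_real_derivative q2 x) (at x)"
    and cont: "continuous_on UNIV q2" and per: "\<And>x. q (x + 2 * pi) = q x"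
    and mean: "integral {0..2*pi} q = 0"
  shows "integral {0..2*pi} (\<lambda>x. q x * (q x + q2 x)) \<le> 0"
proof -
  have contq: "continuous_on S q" "continuous_on S q1" "continuous_on S q2" for S
    using q q1 cont continuous_on_subset
    by (blast intro: DERIV_continuous continuous_at_imp_continuous_on)+
  have per1: "q1 (x + 2 * pi) = q1 x" for x
    using periodic_derivative[of q q1 "2*pi"] q per
    by (simp add: has_real_derivative_iff_has_vector_derivative)
  have "((\<lambda>x. q x * q1 x) has_real_derivative (q1 x)\<^sup>2 + q x * q2 x) (at x)" for x
    by (rule derivative_eq_intros q q1 refl | simp add: power2_eq_square)+
  from integral_of_derivative[OF this, of 0 "2*pi"]
  have "integral {0..2*pi} (\<lambda>x. (q1 x)\<^sup>2 + q x * q2 x) = 0"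
    using per[of 0] per1[of 0] by simp
  moreover have "integral {0..2*pi} (\<lambda>x. (q1 x)\<^sup>2 + q x * q2 x) =
      integral {0..2*pi} (\<lambda>x. (q1 x)\<^sup>2) + integral {0..2*pi} (\<lambda>x. q x * q2 x)"
    by (intro Henstock_Kurzweil_Integration.integral_add integrable_continuous_real continuous_on_mult continuous_on_power contq)
  moreover have "integral {0..2*pi} (\<lambda>x. q x * (q x + q2 x)) =
      integral {0..2*pi} (\<lambda>x. (q x)\<^sup>2) + integral {0..2*pi} (\<lambda>x. q x * q2 x)"
    unfolding distrib_left power2_eq_square
    by (intro Henstock_Kurzweil_Integration.integral_add integrable_continuous_real continuous_on_mult contq)
  moreover have "integral {0..2*pi} (\<lambda>x. (q x)\<^sup>2) \<le> integral {0..2*pi} (\<lambda>x. (q1 x)\<^sup>2)"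
    by (rule Wirtinger_inequality[OF q contq(2) per mean])
  ultimately show ?thesis by linarith
qed

text \<open>
  Oddness and evenness refer to the half turn \<open>x \<mapsto> x + pi\<close>, which acts as an involution
  on functions of period \<open>2 pi\<close>.
\<close>

definition odd_part :: "(real \<Rightarrow> real) \<Rightarrow> real \<Rightarrow> real" where
  "odd_part q x = (q x - q (x + pi)) / 2"

definition even_part :: "(real \<Rightarrow> real) \<Rightarrow> real \<Rightarrow> real" where
  "even_part q x = (q x + q (x + pi)) / 2"

lemma odd_even_part_derivative:
  assumes q: "\<And>x. (q has_real_derivative q1 x) (at x)"
  shows "(odd_part q has_real_derivative odd_part q1 x) (at x)"
    and "(even_part q has_real_derivative even_part q1 x) (at x)"
proof -
  have s: "((\<lambda>x. q (x + pi)) has_real_derivative q1 (x + pi)) (at x)"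
    by (rule DERIV_shift[THEN iffD1, OF q])
  show "(odd_part q has_real_derivative odd_part q1 x) (at x)"
    unfolding odd_part_def[abs_def] by (intro DERIV_cdivide DERIV_diff q s)
  show "(even_part q has_real_derivative even_part q1 x) (at x)"
    unfolding even_part_def[abs_def] by (intro DERIV_cdivide DERIV_add q s)
qed

lemma continuous_on_odd_even_part:
  assumes "continuous_on UNIV q"
  shows "continuous_on S (odd_part q)" "continuous_on S (even_part q)"
proof -
  have 1: "continuous_on S q" using assms continuous_on_subset by blast
  have "continuous_on S (\<lambda>x. x + pi)" by (intro continuous_intros)
  from continuous_on_compose2[OF assms this] have 2: "continuous_on S (\<lambda>x. q (x + pi))" by simp
  show "continuous_on S (odd_part q)" "continuous_on S (even_part q)"
    unfolding odd_part_def[abs_def] even_part_def[abs_def]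
    by (intro continuous_on_divide continuous_on_diff continuous_on_add continuous_on_const 1 2; simp)+
qed

lemma odd_even_part_shift:
  assumes "\<And>x. q (x + 2 * pi) = q x"
  shows "odd_part q (x + pi) = - odd_part q x" "even_part q (x + pi) = even_part q x"
  using assms[of x] by (simp_all add: odd_part_def even_part_def add.assoc diff_divide_distrib add.commute)

text \<open>
  The quadratic form \<open>\<integral> q (q + q'')\<close> has no mixed terms between the odd and the even part: they are
  antisymmetric under the half turn.
\<close>

lemma integral_support_area_split:
  fixes q q2 :: "real \<Rightarrow> real"
  assumes cont: "continuous_on UNIV q" "continuous_on UNIV q2"
    and per: "\<And>x. q (x + 2 * pi) = q x" "\<And>x. q2 (x + 2 * pi) = q2 x"
  shows "integral {0..2*pi} (\<lambda>x. q x * (q x + q2 x)) =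
      integral {0..2*pi} (\<lambda>x. odd_part q x * (odd_part q x + odd_part q2 x)) +
      integral {0..2*pi} (\<lambda>x. even_part q x * (even_part q x + even_part q2 x))"
proof -
  let ?o = "odd_part q" and ?o2 = "odd_part q2" and ?e = "even_part q" and ?e2 = "even_part q2"
  note c = continuous_on_odd_even_part[OF cont(1)] continuous_on_odd_even_part[OF cont(2)]
  note sh = odd_even_part_shift[of q, OF per(1)] odd_even_part_shift[of q2, OF per(2)]
  \<comment> \<open>The mixed terms.\<close>
  define X where "X = (\<lambda>x. ?o x * (?e x + ?e2 x) + ?e x * (?o x + ?o2 x))"
  have contX: "continuous_on S X" for S
    unfolding X_def by (intro continuous_on_add continuous_on_mult c)
  have "X (x + pi) = - 1 * X x" for x
    unfolding X_def sh by (simp add: ring_distribs)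
  from integral_half_periods[OF contX this] have X: "integral {0..2*pi} X = 0"
    by simp
  have "q x * (q x + q2 x) = (?o x * (?o x + ?o2 x) + ?e x * (?e x + ?e2 x)) + X x" for x
  proof -
    have "q x = ?o x + ?e x" "q2 x = ?o2 x + ?e2 x"
      by (simp_all add: odd_part_def even_part_def field_simps)
    then show ?thesis by (simp add: X_def algebra_simps)
  qed
  then have "integral {0..2*pi} (\<lambda>x. q x * (q x + q2 x)) =
      integral {0..2*pi} (\<lambda>x. (?o x * (?o x + ?o2 x) + ?e x * (?e x + ?e2 x)) + X x)"
    by simp
  also have "\<dots> = integral {0..2*pi} (\<lambda>x. ?o x * (?o x + ?o2 x)) +
      integral {0..2*pi} (\<lambda>x. ?e x * (?e x + ?e2 x)) + integral {0..2*pi} X"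
    by (subst Henstock_Kurzweil_Integration.integral_add,
        intro integrable_continuous_real continuous_on_add continuous_on_mult c, rule integrable_continuous_real[OF contX],
        subst Henstock_Kurzweil_Integration.integral_add)
      (intro integrable_continuous_real continuous_on_add continuous_on_mult c | simp)+
  finally show ?thesis by (simp add: X)
qed

text \<open>
  Both summands of the previous lemma are nonpositive, so the absolute value is additive. The
  contribution of the odd part is written over half of the period, because its integrand has
  period \<open>pi\<close>.
\<close>

lemma abs_support_area_split:
  fixes q q1 q2 :: "real \<Rightarrow> real"
  assumes q: "\<And>x. (q has_real_derivative q1 x) (at x)" and q1: "\<And>x. (q1 has_real_derivative q2 x) (at x)"
    and cont: "continuous_on UNIV q2" and per: "\<And>x. q (x + 2 * pi) = q x"
    and mean: "integral {0..2*pi} q = 0"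
  shows "\<bar>integral {0..2*pi} (\<lambda>x. q x * (q x + q2 x))\<bar> =
      2 * \<bar>integral {0..pi} (\<lambda>x. odd_part q x * (odd_part q x + odd_part q2 x))\<bar> +
      \<bar>integral {0..2*pi} (\<lambda>x. even_part q x * (even_part q x + even_part q2 x))\<bar>"
proof -
  have contq: "continuous_on UNIV q"
    using q by (blast intro: DERIV_continuous continuous_at_imp_continuous_on)
  have per1: "q1 (x + 2 * pi) = q1 x" for x
    using periodic_derivative[of q q1 "2*pi"] q per
    by (simp add: has_real_derivative_iff_has_vector_derivative)
  have per2: "q2 (x + 2 * pi) = q2 x" for x
    using periodic_derivative[of q1 q2 "2*pi"] q1 per1
    by (simp add: has_real_derivative_iff_has_vector_derivative)
  note c = continuous_on_odd_even_part[OF contq] continuous_on_odd_even_part[OF cont]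
  note sh = odd_even_part_shift[of q, OF per] odd_even_part_shift[of q2, OF per2]
  define Io where "Io = integral {0..2*pi} (\<lambda>x. odd_part q x * (odd_part q x + odd_part q2 x))"
  define Ie where "Ie = integral {0..2*pi} (\<lambda>x. even_part q x * (even_part q x + even_part q2 x))"
  have per_parts: "odd_part q (x + 2 * pi) = odd_part q x" "even_part q (x + 2 * pi) = even_part q x" for x
  proof -
    have "x + 2 * pi = x + pi + pi" by simp
    then show "odd_part q (x + 2 * pi) = odd_part q x" "even_part q (x + 2 * pi) = even_part q x"
      by (simp_all only: sh minus_minus)
  qed
  have odd_mean: "integral {0..2*pi} (odd_part q) = 0"
    using integral_half_periods[of "odd_part q" pi "-1"] c(1) by (simp add: sh)
  have even_mean: "integral {0..2*pi} (even_part q) = 0"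
  proof -
    have "(\<lambda>x. q x - odd_part q x) = even_part q"
      by (auto simp: odd_part_def even_part_def field_simps)
    moreover have "integral {0..2*pi} (\<lambda>x. q x - odd_part q x) = integral {0..2*pi} q - integral {0..2*pi} (odd_part q)"
      using contq continuous_on_subset
      by (intro Henstock_Kurzweil_Integration.integral_diff integrable_continuous_real c) blast
    ultimately show ?thesis by (simp add: mean odd_mean)
  qed
  have "Io \<le> 0"
    unfolding Io_def
    by (rule integral_support_area_nonpos[OF odd_even_part_derivative(1)[OF q] odd_even_part_derivative(1)[OF q1] c(3) per_parts(1) odd_mean])
  moreover have "Ie \<le> 0"
    unfolding Ie_def
    by (rule integral_support_area_nonpos[OF odd_even_part_derivative(2)[OF q] odd_even_part_derivative(2)[OF q1] c(4) per_parts(2) even_mean])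
  moreover have "integral {0..2*pi} (\<lambda>x. q x * (q x + q2 x)) = Io + Ie"
    unfolding Io_def Ie_def by (rule integral_support_area_split[OF contq cont per per2])
  moreover have "Io = 2 * integral {0..pi} (\<lambda>x. odd_part q x * (odd_part q x + odd_part q2 x))"
    unfolding Io_def
    by (rule integral_half_periods[where c = 1, simplified])
      (auto simp: sh algebra_simps intro!: continuous_on_mult continuous_on_add c)
  ultimately show ?thesis
    unfolding Ie_def[symmetric] by linarith
qed

definition radial :: "real \<Rightarrow> real ^ 2" where
  "radial \<theta> = vector [cos \<theta>, sin \<theta>]"

definition tangential :: "real \<Rightarrow> real ^ 2" where
  "tangential \<theta> = vector [- sin \<theta>, cos \<theta>]"

lemma radial_tangential_nth [simp]:
  "radial \<theta> $ 1 = cos \<theta>" "radial \<theta> $ 2 = sin \<theta>" "tangential \<theta> $ 1 = - sin \<theta>" "tangential \<theta> $ 2 = cos \<theta>"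
  by (simp_all add: radial_def tangential_def)

lemma vec2_eq_iff: "x = y \<longleftrightarrow> x $ 1 = y $ 1 \<and> x $ 2 = y $ 2" for x y :: "real ^ 2"
  by (simp add: vec_eq_iff forall_2)

lemma inner_vec2: "x \<bullet> y = x $ 1 * y $ 1 + x $ 2 * y $ 2" for x y :: "real ^ 2"
  by (simp add: inner_vec_def sum_2)

lemma radial_tangential_inner [simp]:
  "radial \<theta> \<bullet> radial \<theta> = 1" "tangential \<theta> \<bullet> tangential \<theta> = 1" "radial \<theta> \<bullet> tangential \<theta> = 0" "tangential \<theta> \<bullet> radial \<theta> = 0"
  by (simp_all add: inner_vec2 flip: power2_eq_square)

lemma radial_tangential_add_pi [simp]: "radial (\<theta> + pi) = - radial \<theta>" "tangential (\<theta> + pi) = - tangential \<theta>"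
  by (simp_all add: vec2_eq_iff)

lemma norm_radial_tangential [simp]: "norm (radial \<theta>) = 1" "norm (tangential \<theta>) = 1"
  by (simp_all add: norm_eq_1)

lemma vec2_frame: "x = (x \<bullet> radial \<theta>) *\<^sub>R radial \<theta> + (x \<bullet> tangential \<theta>) *\<^sub>R tangential \<theta>"
proof -
  have "x $ 1 = (x $ 1 * cos \<theta> + x $ 2 * sin \<theta>) * cos \<theta> - (x $ 2 * cos \<theta> - x $ 1 * sin \<theta>) * sin \<theta>"
    "x $ 2 = (x $ 1 * cos \<theta> + x $ 2 * sin \<theta>) * sin \<theta> + (x $ 2 * cos \<theta> - x $ 1 * sin \<theta>) * cos \<theta>"
    using sin_cos_squared_add[of \<theta>] by algebra+
  then show ?thesis
    by (simp add: vec2_eq_iff inner_vec2)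
qed

lemma radial_tangential_derivative:
  "(radial has_vector_derivative tangential \<theta>) (at \<theta>)" "(tangential has_vector_derivative - radial \<theta>) (at \<theta>)"
proof -
  have *: "radial = (\<lambda>\<theta>. cos \<theta> *\<^sub>R axis 1 1 + sin \<theta> *\<^sub>R axis 2 1)"
    "tangential = (\<lambda>\<theta>. - sin \<theta> *\<^sub>R axis 1 1 + cos \<theta> *\<^sub>R axis 2 1)"
    by (auto simp: vec2_eq_iff axis_def)
  show "(radial has_vector_derivative tangential \<theta>) (at \<theta>)"
    unfolding * by (auto intro!: derivative_eq_intros)
  show "(tangential has_vector_derivative - radial \<theta>) (at \<theta>)"
    unfolding * by (auto intro!: derivative_eq_intros)
qed

text \<open>
  The velocity of \<open>q u + q' u'\<close>, where \<open>u\<close> is the radial direction, is \<open>(q + q'') u'\<close>, and its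
  determinant with the position is \<open>q (q + q'')\<close>.
\<close>

lemma oriented_area_support:
  assumes C: "\<And>\<theta>. C \<theta> = q \<theta> *\<^sub>R radial \<theta> + q1 \<theta> *\<^sub>R tangential \<theta>"
    and q: "\<And>x. (q has_real_derivative q1 x) (at x)" and q1: "\<And>x. (q1 has_real_derivative q2 x) (at x)"
  shows "oriented_area C a b = 1 / 2 * integral {a..b} (\<lambda>\<theta>. q \<theta> * (q \<theta> + q2 \<theta>))"
proof -
  have "(C has_vector_derivative
      (q \<theta> *\<^sub>R tangential \<theta> + q1 \<theta> *\<^sub>R radial \<theta>) + (q1 \<theta> *\<^sub>R (- radial \<theta>) + q2 \<theta> *\<^sub>R tangential \<theta>)) (at \<theta>)" for \<theta>
    unfolding C[abs_def]
    by (intro has_vector_derivative_add has_vector_derivative_scaleR q q1 radial_tangential_derivative)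
  then have v: "velocity C \<theta> = (q \<theta> + q2 \<theta>) *\<^sub>R tangential \<theta>" for \<theta>
    unfolding velocity_def by (simp add: vector_derivative_at algebra_simps)
  have "- (C \<theta> $ 2) * velocity C \<theta> $ 1 + C \<theta> $ 1 * velocity C \<theta> $ 2 = q \<theta> * (q \<theta> + q2 \<theta>)" for \<theta>
    unfolding v C
    by (simp only: radial_tangential_nth vector_add_component vector_scaleR_component real_scaleR_def)
      (use sin_cos_squared_add[of \<theta>] in algebra)
  then show ?thesis
    unfolding oriented_area_def by simp
qed

section \<open>Ovals parametrized by the normal angle\<close>

text \<open>
  \<open>\<gamma>\<close> traverses the curve so that the outer normal at \<open>\<gamma> \<theta>\<close> is \<open>radial \<theta>\<close>; then \<open>\<rho>\<close> is the
  radius of curvature. The period \<open>2 * pi\<close> records that the normal makes one turn only.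
\<close>

locale normal_angle_parametrization =
  fixes M :: "real \<Rightarrow> real ^ 2" and T :: real and \<gamma> :: "real \<Rightarrow> real ^ 2" and \<rho> :: "real \<Rightarrow> real"
  assumes range_eq: "range M = range \<gamma>"
    and \<gamma>_derivative: "(\<gamma> has_vector_derivative \<rho> \<theta> *\<^sub>R tangential \<theta>) (at \<theta>)"
    and \<rho>_pos: "0 < \<rho> \<theta>" and continuous_\<rho>: "continuous_on UNIV \<rho>"
    and \<gamma>_periodic: "\<gamma> (\<theta> + 2 * pi) = \<gamma> \<theta>"
    and tangent: "\<exists>s>0. tangent_vector M (\<gamma> \<theta>) = s *\<^sub>R tangential \<theta>"
    and length: "curve_length M T = integral {0..2*pi} \<rho>"
begin

text \<open>
  These are the coordinates of \<open>\<gamma> \<theta>\<close> in the frame formed by the normal and the tangent at this point. The first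
  one turns out to be the support function (\<open>support_function_eq\<close>), the second one its derivative.
\<close>

definition "p \<theta> = \<gamma> \<theta> \<bullet> radial \<theta>"
definition "p1 \<theta> = \<gamma> \<theta> \<bullet> tangential \<theta>"

lemma \<gamma>_eq: "\<gamma> \<theta> = p \<theta> *\<^sub>R radial \<theta> + p1 \<theta> *\<^sub>R tangential \<theta>"
  unfolding p_def p1_def by (rule vec2_frame)

lemma p_derivative: "(p has_real_derivative p1 \<theta>) (at \<theta>)"
proof -
  have "((\<lambda>\<theta>. \<gamma> \<theta> \<bullet> radial \<theta>) has_vector_derivative
      (\<gamma> \<theta> \<bullet> tangential \<theta> + (\<rho> \<theta> *\<^sub>R tangential \<theta>) \<bullet> radial \<theta>)) (at \<theta>)"
    by (rule bounded_bilinear.has_vector_derivative[OF bounded_bilinear_inner \<gamma>_derivative radial_tangential_derivative(1)])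
  then show ?thesis
    by (simp add: p_def[abs_def] p1_def has_real_derivative_iff_has_vector_derivative)
qed

lemma p1_derivative: "(p1 has_real_derivative \<rho> \<theta> - p \<theta>) (at \<theta>)"
proof -
  have "((\<lambda>\<theta>. \<gamma> \<theta> \<bullet> tangential \<theta>) has_vector_derivative
      (\<gamma> \<theta> \<bullet> (- radial \<theta>) + (\<rho> \<theta> *\<^sub>R tangential \<theta>) \<bullet> tangential \<theta>)) (at \<theta>)"
    by (rule bounded_bilinear.has_vector_derivative[OF bounded_bilinear_inner \<gamma>_derivative radial_tangential_derivative(2)])
  then show ?thesis
    by (simp add: p_def p1_def[abs_def] has_real_derivative_iff_has_vector_derivative)
qed

lemma p_periodic: "p (\<theta> + 2 * pi) = p \<theta>" "p1 (\<theta> + 2 * pi) = p1 \<theta>"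
  by (simp_all add: p_def p1_def \<gamma>_periodic inner_vec2)

lemma continuous_p: "continuous_on S p"
  using p_derivative by (blast intro: DERIV_continuous continuous_at_imp_continuous_on)

text \<open>
  Cauchy's formula: the length is the integral of the radius of curvature \<open>\<rho> = p + p''\<close>.
\<close>

lemma length_eq_integral_support: "curve_length M T = integral {0..2*pi} p"
proof -
  have "integral {0..2*pi} (\<lambda>\<theta>. \<rho> \<theta> - p \<theta>) = 0"
    using integral_of_derivative[OF p1_derivative, of 0 "2*pi"] p_periodic(2)[of 0] by simp
  moreover have "integral {0..2*pi} (\<lambda>\<theta>. \<rho> \<theta> - p \<theta>) = integral {0..2*pi} \<rho> - integral {0..2*pi} p"
    using continuous_\<rho> continuous_on_subset
    by (intro Henstock_Kurzweil_Integration.integral_diff integrable_continuous_real continuous_p) blast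
  ultimately show ?thesis by (simp add: length)
qed

lemma height_derivative:
  "((\<lambda>\<eta>. \<gamma> \<eta> \<bullet> radial \<theta>) has_real_derivative \<rho> \<eta> * sin (\<theta> - \<eta>)) (at \<eta>)"
proof -
  have "((\<lambda>\<eta>. \<gamma> \<eta> \<bullet> radial \<theta>) has_vector_derivative (\<rho> \<eta> *\<^sub>R tangential \<eta>) \<bullet> radial \<theta>) (at \<eta>)"
    by (rule bounded_linear.has_vector_derivative[OF bounded_linear_inner_left \<gamma>_derivative])
  then show ?thesis
    by (simp add: has_real_derivative_iff_has_vector_derivative inner_vec2 sin_diff algebra_simps)
qed

text \<open>
  By the preceding derivative, the height in the direction \<open>radial \<theta>\<close> increases on \<open>[\<theta> - pi, \<theta>]\<close> and decreases
  on \<open>[\<theta>, \<theta> + pi]\<close>. This is where the single turn of the normal yields global convexity.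
\<close>

lemma height_less_support:
  assumes "\<eta> \<in> {\<theta> - pi..\<theta> + pi}" "\<eta> \<noteq> \<theta>"
  shows "\<gamma> \<eta> \<bullet> radial \<theta> < p \<theta>"
proof (cases "\<eta> < \<theta>")
  case True
  have "\<gamma> \<eta> \<bullet> radial \<theta> < \<gamma> \<theta> \<bullet> radial \<theta>"
  proof (rule DERIV_pos_imp_increasing_open[OF True])
    fix x assume "\<eta> < x" "x < \<theta>"
    then have "0 < \<rho> x * sin (\<theta> - x)"
      using assms by (intro mult_pos_pos \<rho>_pos sin_gt_zero) auto
    then show "\<exists>y. ((\<lambda>\<eta>. \<gamma> \<eta> \<bullet> radial \<theta>) has_real_derivative y) (at x) \<and> 0 < y"
      using height_derivative by blast
  qed (use height_derivative in \<open>blast intro: DERIV_continuous continuous_at_imp_continuous_on\<close>)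
  then show ?thesis by (simp add: p_def)
next
  case False
  with assms have less: "\<theta> < \<eta>" by simp
  have "\<gamma> \<eta> \<bullet> radial \<theta> < \<gamma> \<theta> \<bullet> radial \<theta>"
  proof (rule DERIV_neg_imp_decreasing_open[OF less])
    fix x assume "\<theta> < x" "x < \<eta>"
    then have "0 < \<rho> x * sin (x - \<theta>)"
      using assms by (intro mult_pos_pos \<rho>_pos sin_gt_zero) auto
    also have "\<rho> x * sin (x - \<theta>) = - (\<rho> x * sin (\<theta> - x))"
      by (simp add: sin_diff algebra_simps)
    finally have "\<rho> x * sin (\<theta> - x) < 0" by simp
    then show "\<exists>y. ((\<lambda>\<eta>. \<gamma> \<eta> \<bullet> radial \<theta>) has_real_derivative y) (at x) \<and> y < 0"
      using height_derivative by blast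
  qed (use height_derivative in \<open>blast intro: DERIV_continuous continuous_at_imp_continuous_on\<close>)
  then show ?thesis by (simp add: p_def)
qed

lemma support_function_eq: "support_function M = p"
proof
  fix \<theta>
  have "\<gamma> \<eta> \<bullet> radial \<theta> \<le> p \<theta>" for \<eta>
  proof -
    obtain k :: int where k: "\<eta> + of_int k * (2 * pi) \<in> {\<theta> - pi..<\<theta> - pi + 2 * pi}"
      using reduce_mod_period[of "2 * pi"] mult_pos_pos[OF zero_less_numeral pi_gt_zero] by blast
    have "\<gamma> (\<eta> + of_int k * (2 * pi)) \<bullet> radial \<theta> \<le> p \<theta>"
      using height_less_support[of "\<eta> + of_int k * (2 * pi)" \<theta>] k
      by (cases "\<eta> + of_int k * (2 * pi) = \<theta>") (auto simp: p_def)
    then show ?thesis by (simp add: periodic_of_int[of \<gamma>, OF \<gamma>_periodic])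
  qed
  then have "(SUP a\<in>range \<gamma>. a \<bullet> radial \<theta>) = p \<theta>"
    by (intro cSup_eq_maximum) (auto simp: p_def)
  then show "support_function M \<theta> = p \<theta>"
    by (simp add: support_function_def range_eq radial_def)
qed

lemma support_param_eq: "support_param M = \<gamma>"
proof
  fix \<theta>
  have "deriv p \<theta> = p1 \<theta>" using p_derivative by (rule DERIV_imp_deriv)
  then show "support_param M \<theta> = \<gamma> \<theta>"
    by (simp add: support_param_def support_function_eq \<gamma>_eq vec2_eq_iff Let_def)
qed

lemma unit_normal_eq: "unit_normal M (\<gamma> \<theta>) = - radial \<theta>"
proof -
  obtain s where "0 < s" "tangent_vector M (\<gamma> \<theta>) = s *\<^sub>R tangential \<theta>"
    using tangent by blast
  then have "sgn (tangent_vector M (\<gamma> \<theta>)) = tangential \<theta>"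
    by (simp add: sgn_div_norm)
  then show ?thesis
    by (simp add: unit_normal_def vec2_eq_iff)
qed

abbreviation "m \<equiv> curve_length M T / (2 * pi)"

text \<open>
  The support functions of the SMS, the Wigner caustic and the CWMS are \<open>q = p - m\<close>, its odd part,
  and twice its even part.
\<close>

lemma area_identity:
  "4 * \<bar>SMS_area M T\<bar> = 8 * \<bar>wigner_caustic_area M\<bar> + \<bar>CWMS_area M T\<bar>"
proof -
  define q where "q = (\<lambda>\<theta>. p \<theta> - m)"
  define q2 where "q2 = (\<lambda>\<theta>. \<rho> \<theta> - p \<theta>)"
  have q: "(q has_real_derivative p1 \<theta>) (at \<theta>)" for \<theta>
    unfolding q_def by (rule derivative_eq_intros p_derivative refl | simp)+
  have q1: "(p1 has_real_derivative q2 \<theta>) (at \<theta>)" for \<theta>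
    unfolding q2_def by (rule p1_derivative)
  have q_per: "q (\<theta> + 2 * pi) = q \<theta>" for \<theta>
    by (simp add: q_def p_periodic)
  have "continuous_on UNIV q2"
    unfolding q2_def by (intro continuous_on_diff continuous_\<rho> continuous_p)
  moreover have "integral {0..2*pi} q = 0"
  proof -
    have "integral {0..2*pi} q = integral {0..2*pi} p - integral {0..2*pi} (\<lambda>_. m)"
      unfolding q_def
      by (intro Henstock_Kurzweil_Integration.integral_diff integrable_continuous_real continuous_p continuous_on_const)
    also have "\<dots> = 0"
      by (simp add: length_eq_integral_support)
    finally show ?thesis .
  qed
  ultimately have split: "\<bar>integral {0..2*pi} (\<lambda>x. q x * (q x + q2 x))\<bar> =
      2 * \<bar>integral {0..pi} (\<lambda>x. odd_part q x * (odd_part q x + odd_part q2 x))\<bar> +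
      \<bar>integral {0..2*pi} (\<lambda>x. even_part q x * (even_part q x + even_part q2 x))\<bar>"
    by (intro abs_support_area_split[OF q q1 _ q_per])
  have "SMS_param M T \<theta> = q \<theta> *\<^sub>R radial \<theta> + p1 \<theta> *\<^sub>R tangential \<theta>" for \<theta>
    unfolding SMS_param_def support_param_eq unit_normal_eq unfolding \<gamma>_eq[of \<theta>] by (simp add: q_def algebra_simps)
  from oriented_area_support[OF this q q1]
  have SMS: "SMS_area M T = 1 / 2 * integral {0..2*pi} (\<lambda>x. q x * (q x + q2 x))"
    unfolding SMS_area_def .
  have "wigner_caustic_param M \<theta> = odd_part q \<theta> *\<^sub>R radial \<theta> + odd_part p1 \<theta> *\<^sub>R tangential \<theta>" for \<theta>
    unfolding wigner_caustic_param_def support_param_eq unfolding \<gamma>_eq[of \<theta>] \<gamma>_eq[of "\<theta> + pi"]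
    by (simp add: odd_part_def q_def vec2_eq_iff field_simps)
  from oriented_area_support[OF this odd_even_part_derivative(1)[OF q] odd_even_part_derivative(1)[OF q1]]
  have W: "wigner_caustic_area M = 1 / 2 * integral {0..pi} (\<lambda>x. odd_part q x * (odd_part q x + odd_part q2 x))"
    unfolding wigner_caustic_area_def .
  have "CWMS_param M T \<theta> = (2 * even_part q \<theta>) *\<^sub>R radial \<theta> + (2 * even_part p1 \<theta>) *\<^sub>R tangential \<theta>" for \<theta>
    unfolding CWMS_param_def support_param_eq unit_normal_eq unfolding \<gamma>_eq[of \<theta>] \<gamma>_eq[of "\<theta> + pi"]
    by (simp add: average_width_def even_part_def q_def vec2_eq_iff field_simps)
  from oriented_area_support[OF this DERIV_cmult[OF odd_even_part_derivative(2)[OF q]]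
      DERIV_cmult[OF odd_even_part_derivative(2)[OF q1]], of 0 "2 * pi"]
  have "CWMS_area M T = 1 / 2 * integral {0..2*pi} (\<lambda>x. 4 * (even_part q x * (even_part q x + even_part q2 x)))"
    unfolding CWMS_area_def by (simp add: algebra_simps)
  then have C: "CWMS_area M T = 2 * integral {0..2*pi} (\<lambda>x. even_part q x * (even_part q x + even_part q2 x))"
    by simp
  show ?thesis
    using split unfolding SMS W C abs_mult by simp
qed

lemma tangent_line_eq: "tangent_line M (\<gamma> \<theta>) = {\<gamma> \<theta> + s *\<^sub>R tangential \<theta> | s. True}"
proof -
  obtain r where r: "0 < r" "tangent_vector M (\<gamma> \<theta>) = r *\<^sub>R tangential \<theta>"
    using tangent by blast
  have "\<exists>t. s *\<^sub>R tangential \<theta> = (t * r) *\<^sub>R tangential \<theta>" for s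
    using r(1) by (intro exI[of _ "s / r"]) simp
  then show ?thesis
    unfolding tangent_line_def r by auto
qed

text \<open>
  The tangents at \<open>\<gamma> \<theta>\<close> and \<open>\<gamma> \<eta>\<close> are parallel only if \<open>\<eta> - \<theta>\<close> is a multiple of \<open>pi\<close>. An even
  multiple gives the same point, an odd one the opposite point; the two opposite points are
  distinct because their heights in the direction \<open>radial \<theta>\<close> differ.
\<close>

lemma parallel_pair_iff: "parallel_pair M a b \<longleftrightarrow> (\<exists>\<theta>. a = \<gamma> \<theta> \<and> b = \<gamma> (\<theta> + pi))"
proof
  assume "parallel_pair M a b"
  then obtain \<theta> \<eta> where ab: "a = \<gamma> \<theta>" "b = \<gamma> \<eta>" "a \<noteq> b"
    and par: "affine_parallel (tangent_line M (\<gamma> \<theta>)) (tangent_line M (\<gamma> \<eta>))"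
    unfolding parallel_pair_def range_eq by auto
  from par obtain c where c: "tangent_line M (\<gamma> \<eta>) = (+) c ` tangent_line M (\<gamma> \<theta>)"
    unfolding affine_parallel_def by auto
  have "\<gamma> \<eta> + 0 *\<^sub>R tangential \<eta> \<in> tangent_line M (\<gamma> \<eta>)" "\<gamma> \<eta> + 1 *\<^sub>R tangential \<eta> \<in> tangent_line M (\<gamma> \<eta>)"
    unfolding tangent_line_eq by blast+
  then have "\<exists>s. \<gamma> \<eta> = c + (\<gamma> \<theta> + s *\<^sub>R tangential \<theta>)" "\<exists>t. \<gamma> \<eta> + tangential \<eta> = c + (\<gamma> \<theta> + t *\<^sub>R tangential \<theta>)"
    unfolding c unfolding tangent_line_eq by auto
  then obtain s t where "\<gamma> \<eta> = c + (\<gamma> \<theta> + s *\<^sub>R tangential \<theta>)" "\<gamma> \<eta> + tangential \<eta> = c + (\<gamma> \<theta> + t *\<^sub>R tangential \<theta>)"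
    by blast
  then have "tangential \<eta> = (t - s) *\<^sub>R tangential \<theta>"
    by (simp add: algebra_simps)
  then have "tangential \<eta> \<bullet> radial \<theta> = 0" by simp
  then have "sin (\<eta> - \<theta>) = 0" by (simp add: inner_vec2 sin_diff algebra_simps)
  then obtain i :: int where i: "\<eta> = \<theta> + of_int i * pi"
    by (auto simp: sin_zero_iff_int2 algebra_simps)
  show "\<exists>\<theta>. a = \<gamma> \<theta> \<and> b = \<gamma> (\<theta> + pi)"
  proof (cases "even i")
    case True
    then obtain k where "i = 2 * k" by blast
    then have "\<eta> = \<theta> + of_int k * (2 * pi)" using i by simp
    with ab show ?thesis by (simp add: periodic_of_int[of \<gamma>, OF \<gamma>_periodic])
  next
    case False
    then obtain k where "i = 2 * k + 1" by (blast elim: oddE)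
    then have "\<eta> = (\<theta> + pi) + of_int k * (2 * pi)" using i by (simp add: algebra_simps)
    with ab show ?thesis by (auto simp: periodic_of_int[of \<gamma>, OF \<gamma>_periodic])
  qed
next
  assume "\<exists>\<theta>. a = \<gamma> \<theta> \<and> b = \<gamma> (\<theta> + pi)"
  then obtain \<theta> where ab: "a = \<gamma> \<theta>" "b = \<gamma> (\<theta> + pi)" by blast
  have "a \<noteq> b"
    using height_less_support[of "\<theta> + pi" \<theta>] by (auto simp: ab p_def)
  moreover have "tangent_line M b = (+) (b - a) ` tangent_line M a"
  proof -
    have "tangent_line M b = range (\<lambda>s. b + s *\<^sub>R - tangential \<theta>)"
      unfolding ab tangent_line_eq radial_tangential_add_pi by blast
    also have "\<dots> = (\<lambda>s. b + s *\<^sub>R tangential \<theta>) ` range uminus"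
      by (simp only: image_image scaleR_minus_left scaleR_minus_right)
    also have "\<dots> = range (\<lambda>s. (b - a) + (a + s *\<^sub>R tangential \<theta>))"
      by (simp add: surj_uminus)
    also have "\<dots> = (+) (b - a) ` tangent_line M a"
      unfolding ab(1) tangent_line_eq by blast
    finally show ?thesis .
  qed
  ultimately show "parallel_pair M a b"
    unfolding parallel_pair_def affine_parallel_def range_eq by (auto simp: ab)
qed

lemma chord_eq:
  "\<gamma> \<theta> - \<gamma> (\<theta> + pi) = (p \<theta> + p (\<theta> + pi)) *\<^sub>R radial \<theta> + (p1 \<theta> + p1 (\<theta> + pi)) *\<^sub>R tangential \<theta>"
  unfolding \<gamma>_eq[of \<theta>] \<gamma>_eq[of "\<theta> + pi"] by (simp add: scaleR_add_left)

text \<open>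
  The distance of the two lines is realized along their common normal; the chord between the
  points of contact projects onto it with length \<open>p \<theta> + p (\<theta> + pi)\<close>.
\<close>

lemma width_eq:
  "setdist (tangent_line M (\<gamma> \<theta>)) (tangent_line M (\<gamma> (\<theta> + pi))) = p \<theta> + p (\<theta> + pi)"
proof -
  define w where "w = p \<theta> + p (\<theta> + pi)"
  note frame = chord_eq[of \<theta>, folded w_def]
  have "0 < w"
    using height_less_support[of "\<theta> + pi" \<theta>] by (simp add: w_def p_def)
  have "setdist (tangent_line M (\<gamma> \<theta>)) (tangent_line M (\<gamma> (\<theta> + pi))) = dist (\<gamma> \<theta>) (\<gamma> \<theta> - w *\<^sub>R radial \<theta>)"
  proof (rule setdist_unique)
    show "\<gamma> \<theta> \<in> tangent_line M (\<gamma> \<theta>)"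
      unfolding tangent_line_eq by (intro CollectI exI[of _ 0]) simp
    show "\<gamma> \<theta> - w *\<^sub>R radial \<theta> \<in> tangent_line M (\<gamma> (\<theta> + pi))"
    proof -
      have "x - y = u + v \<Longrightarrow> x - u = y + v" for x y u v :: "real ^ 2"
        by (simp add: algebra_simps)
      from this[OF frame] have "\<gamma> \<theta> - w *\<^sub>R radial \<theta> = \<gamma> (\<theta> + pi) + (- (p1 \<theta> + p1 (\<theta> + pi))) *\<^sub>R tangential (\<theta> + pi)"
        by (simp only: radial_tangential_add_pi scaleR_minus_left scaleR_minus_right minus_minus)
      then show ?thesis
        unfolding tangent_line_eq by blast
    qed
    fix x y assume "x \<in> tangent_line M (\<gamma> \<theta>) \<and> y \<in> tangent_line M (\<gamma> (\<theta> + pi))"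
    then obtain s t where "x = \<gamma> \<theta> + s *\<^sub>R tangential \<theta>" "y = \<gamma> (\<theta> + pi) - t *\<^sub>R tangential \<theta>"
      unfolding tangent_line_eq by auto
    then have "x - y = w *\<^sub>R radial \<theta> + (p1 \<theta> + p1 (\<theta> + pi) + s + t) *\<^sub>R tangential \<theta>"
      using frame by (simp add: algebra_simps)
    then have "w = (x - y) \<bullet> radial \<theta>" by (simp add: inner_add_left)
    also have "\<dots> \<le> dist x y"
      using norm_cauchy_schwarz[of "x - y" "radial \<theta>"] by (simp add: dist_norm)
    finally show "dist (\<gamma> \<theta>) (\<gamma> \<theta> - w *\<^sub>R radial \<theta>) \<le> dist x y"
      using \<open>0 < w\<close> by (simp add: dist_norm)
  qed
  then show ?thesis using \<open>0 < w\<close> by (simp add: dist_norm w_def)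
qed

text \<open>
  If \<open>p \<theta> + p (\<theta> + pi)\<close> is constant, its derivative, the tangential component of the chord,
  vanishes. The constant is the average width, as is seen by integrating over a period.
\<close>

lemma constant_width_imp:
  assumes "constant_width M"
  shows "\<gamma> \<theta> - \<gamma> (\<theta> + pi) = average_width M T *\<^sub>R radial \<theta>"
proof -
  from assms obtain w where "\<And>a b. parallel_pair M a b \<Longrightarrow> setdist (tangent_line M a) (tangent_line M b) = w"
    unfolding constant_width_def by blast
  then have w: "p \<theta> + p (\<theta> + pi) = w" for \<theta>
    using width_eq parallel_pair_iff by metis
  have "((\<lambda>\<theta>. p \<theta> + p (\<theta> + pi)) has_real_derivative p1 \<theta> + p1 (\<theta> + pi)) (at \<theta>)"
    by (intro DERIV_add p_derivative DERIV_shift[THEN iffD1, OF p_derivative])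
  then have p1: "p1 \<theta> + p1 (\<theta> + pi) = 0"
    unfolding w using DERIV_unique DERIV_const by blast
  have contp_pi: "continuous_on S (\<lambda>\<theta>. p (\<theta> + pi))" for S
    by (rule continuous_on_compose2[OF continuous_p[of UNIV]]) (auto intro!: continuous_intros)
  have "2 * pi * w = integral {0..2*pi} (\<lambda>\<theta>. p \<theta> + p (\<theta> + pi))"
    by (simp add: w)
  also have "\<dots> = integral {0..2*pi} p + integral {0..2*pi} (\<lambda>\<theta>. p (\<theta> + pi))"
    by (intro Henstock_Kurzweil_Integration.integral_add integrable_continuous_real continuous_p contp_pi)
  also have "integral {0..2*pi} (\<lambda>\<theta>. p (\<theta> + pi)) = integral {pi..pi + 2 * pi} p"
    using integral_shift_argument[OF continuous_p, of 0 "2 * pi" pi] by (simp add: add.commute)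
  also have "\<dots> = integral {0..2*pi} p"
    using integral_period_shift[OF continuous_p, of "2 * pi" pi 0] p_periodic by simp
  finally have "w = average_width M T"
    by (simp add: average_width_def length_eq_integral_support field_simps)
  then show ?thesis
    using p1 w[of \<theta>] by (simp add: chord_eq)
qed

lemma constant_width_sets:
  assumes "constant_width M"
  shows "SMS M T = wigner_caustic M" "CWMS M T = {0}"
proof -
  note c = constant_width_imp[OF assms]
  have "CWMS M T = {\<gamma> \<theta> - \<gamma> (\<theta> + pi) + average_width M T *\<^sub>R unit_normal M (\<gamma> \<theta>) | \<theta>. True}"
    unfolding CWMS_def parallel_pair_iff by blast
  then show "CWMS M T = {0}" by (simp add: c unit_normal_eq)
  have "SMS M T = {\<gamma> \<theta> + m *\<^sub>R unit_normal M (\<gamma> \<theta>) | \<theta>. True}"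
    unfolding SMS_def range_eq by blast
  moreover have "\<gamma> \<theta> + m *\<^sub>R unit_normal M (\<gamma> \<theta>) = (1 / 2) *\<^sub>R (\<gamma> \<theta> + \<gamma> (\<theta> + pi))" for \<theta>
  proof -
    have "m *\<^sub>R radial \<theta> = (1 / 2) *\<^sub>R (\<gamma> \<theta> - \<gamma> (\<theta> + pi))"
      unfolding c by (simp add: average_width_def)
    then have "\<gamma> \<theta> + m *\<^sub>R unit_normal M (\<gamma> \<theta>) = \<gamma> \<theta> - (1 / 2) *\<^sub>R (\<gamma> \<theta> - \<gamma> (\<theta> + pi))"
      by (simp add: unit_normal_eq)
    then show ?thesis by (simp add: vec2_eq_iff field_simps)
  qed
  moreover have "{(1 / 2) *\<^sub>R (\<gamma> \<theta> + \<gamma> (\<theta> + pi)) | \<theta>. True} = wigner_caustic M"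
    unfolding wigner_caustic_def parallel_pair_iff by blast
  ultimately show "SMS M T = wigner_caustic M" by simp
qed

end

section \<open>Existence of the normal angle parametrization\<close>

definition plane_to_complex :: "real ^ 2 \<Rightarrow> complex" where
  "plane_to_complex x = Complex (x $ 1) (x $ 2)"

lemma bounded_linear_plane_to_complex: "bounded_linear plane_to_complex"
  unfolding linear_conv_bounded_linear[symmetric]
  by (rule linearI) (simp_all add: plane_to_complex_def complex_eq_iff)

lemma plane_to_complex_simps [simp]:
  "Re (plane_to_complex x) = x $ 1" "Im (plane_to_complex x) = x $ 2"
  "cmod (plane_to_complex x) = norm x" "plane_to_complex x = plane_to_complex y \<longleftrightarrow> x = y"
  "plane_to_complex x = 0 \<longleftrightarrow> x = 0"
  by (simp_all add: plane_to_complex_def cmod_def norm_eq_sqrt_inner inner_vec2 power2_eq_square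
      vec2_eq_iff complex_eq_iff)

lemma tangent_vector_eq_velocity:
  assumes M: "closed_regular_simple_curve M T" and vel: "\<And>t. (M has_vector_derivative velocity M t) (at t)"
  shows "tangent_vector M (M t) = velocity M t"
proof -
  from M have T: "0 < T" and per: "\<And>t. M (t + T) = M t" and inj: "inj_on M {0..<T}"
    by (auto simp: closed_regular_simple_curve_def)
  have "M (SOME s. M s = M t) = M t" by (rule someI[of _ t]) simp
  then obtain k :: int where "t = (SOME s. M s = M t) + of_int k * T"
    using periodic_inj_on_imp_eq_mod[of M T, OF per inj T] by blast
  then have "velocity M t = velocity M (SOME s. M s = M t)"
    using periodic_of_int[of "velocity M" T] periodic_derivative[OF vel per] by metis
  then show ?thesis by (simp add: tangent_vector_def)
qed

text \<open>
  The derivative of the tangent angle is the curvature times the speed. It is positive, which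
  selects the counterclockwise alternative in the theorem on turning tangents.
\<close>

lemma convex_curve_tangent_angle:
  assumes M: "closed_regular_simple_curve M T" and pos: "positively_oriented M"
  obtains \<phi> \<phi>' where "\<And>t. (\<phi> has_real_derivative \<phi>' t) (at t)" "\<And>t. 0 < \<phi>' t" "continuous_on UNIV \<phi>'"
    "\<And>t. velocity M t = norm (velocity M t) *\<^sub>R radial (\<phi> t)" "\<And>t. \<phi> (t + T) = \<phi> t + 2 * pi"
proof -
  from M have T: "0 < T" and smooth: "smooth_curve M" and per: "\<And>t. M (t + T) = M t"
    and nz: "\<And>t. velocity M t \<noteq> 0" and inj: "inj_on M {0..<T}"
    by (auto simp: closed_regular_simple_curve_def)
  have diff: "((velocity ^^ k) M has_vector_derivative velocity ((velocity ^^ k) M) t) (at t)" for k t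
    using smooth unfolding smooth_curve_def velocity_def
    by (simp flip: vector_derivative_works)
  let ?v = "velocity M" and ?a = "velocity (velocity M)"
  have M1: "(M has_vector_derivative ?v t) (at t)" for t using diff[of 0 t] by simp
  have M2: "(?v has_vector_derivative ?a t) (at t)" for t using diff[of 1 t] by simp
  have M3: "(?a has_vector_derivative velocity ?a t) (at t)" for t
    using diff[of 2 t] by (simp add: numeral_2_eq_2)
  have contv: "continuous_on UNIV ?v" "continuous_on UNIV ?a"
    using M2 M3 has_vector_derivative_continuous by (blast intro: continuous_at_imp_continuous_on)+
  let ?c = plane_to_complex
  note lin = bounded_linear.has_vector_derivative[OF bounded_linear_plane_to_complex]
  obtain \<phi> c where cont: "continuous_on UNIV \<phi>" and polar: "\<And>t. ?c (?v t) = cmod (?c (?v t)) * cis (\<phi> t)"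
    and shift: "\<And>t. \<phi> (t + T) = \<phi> t + 2 * c" and c: "c = pi \<or> c = - pi"
  proof (rule Umlaufsatz[of "\<lambda>t. ?c (M t)" "\<lambda>t. ?c (?v t)" T])
    show "((\<lambda>t. ?c (M t)) has_vector_derivative ?c (?v t)) (at t)" for t by (rule lin[OF M1])
    show "continuous_on UNIV (\<lambda>t. ?c (?v t))"
      by (intro bounded_linear.continuous_on[OF bounded_linear_plane_to_complex] contv)
    show "inj_on (\<lambda>t. ?c (M t)) {0..<T}" using inj by (simp add: inj_on_def)
  qed (use T nz per in auto)
  define \<phi>' where "\<phi>' = (\<lambda>t. signed_curvature M t * norm (?v t))"
  have \<phi>'_eq: "\<phi>' t = (?v t $ 1 * ?a t $ 2 - ?v t $ 2 * ?a t $ 1) / (norm (?v t))\<^sup>2" for t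
    using nz[of t] by (simp add: \<phi>'_def signed_curvature_def Let_def power3_eq_cube power2_eq_square)
  have d: "(\<phi> has_real_derivative \<phi>' t) (at t)" for t
  proof -
    have "(\<phi> has_real_derivative Im (?c (?a t) / ?c (?v t))) (at t)"
      by (rule continuous_angle_has_derivative[OF lin[OF M2] _ _ polar])
        (use nz cont in \<open>auto simp: continuous_on_eq_continuous_at\<close>)
    also have "Im (?c (?a t) / ?c (?v t)) = \<phi>' t"
      by (simp add: \<phi>'_eq Im_divide cmod_power2[of "?c (?v t)", simplified] algebra_simps)
    finally show ?thesis .
  qed
  have \<phi>'_pos: "0 < \<phi>' t" for t
    using pos nz[of t] by (simp add: \<phi>'_def positively_oriented_def)
  have "\<phi> 0 < \<phi> T"
    using DERIV_pos_imp_increasing[OF T, of \<phi>] d \<phi>'_pos by blast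
  with shift[of 0] c pi_gt_zero have "c = pi" by auto
  then have turn: "\<phi> (t + T) = \<phi> t + 2 * pi" for t by (simp add: shift)
  have "continuous_on UNIV \<phi>'"
    unfolding \<phi>'_eq[abs_def] using nz
    by (intro continuous_on_divide continuous_on_diff continuous_on_mult continuous_on_power continuous_on_norm
        continuous_on_component contv) auto
  moreover have "?v t = norm (?v t) *\<^sub>R radial (\<phi> t)" for t
    using arg_cong[OF polar[of t], of Re] arg_cong[OF polar[of t], of Im] by (simp add: vec2_eq_iff)
  ultimately show thesis
    using that[OF d \<phi>'_pos _ _ turn] by blast
qed

text \<open>
  Shifting the argument by multiples of \<open>T\<close> shows that \<open>\<phi>\<close> is unbounded in both directions,
  hence onto.
\<close>

lemma inverse_of_increasing_angle:
  fixes \<phi> \<phi>' :: "real \<Rightarrow> real"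
  assumes d: "\<And>t. (\<phi> has_real_derivative \<phi>' t) (at t)" and pos: "\<And>t. 0 < \<phi>' t"
    and shift: "\<And>t. \<phi> (t + T) = \<phi> t + P" and P: "0 < P"
  obtains \<tau> where "\<And>x. \<phi> (\<tau> x) = x" "\<And>t. \<tau> (\<phi> t) = t" "\<And>x. \<tau> (x + P) = \<tau> x + T"
    "\<And>x. (\<tau> has_real_derivative inverse (\<phi>' (\<tau> x))) (at x)"
proof -
  have mono: "strict_mono \<phi>"
    using DERIV_pos_imp_increasing d pos by (blast intro: strict_monoI)
  have isCont: "isCont \<phi> t" for t using d by (rule DERIV_isCont)
  have "\<exists>t. \<phi> t = x" for x
  proof -
    have int_shift: "\<phi> (of_int k * T) = \<phi> 0 + of_int k * P" for k :: int
    proof -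
      have "T \<noteq> 0" using shift[of 0] P by auto
      then have "\<phi> (t + T) - (t + T) * P / T = \<phi> t - t * P / T" for t
        by (simp add: shift ring_distribs add_divide_distrib)
      from periodic_of_int[of "\<lambda>t. \<phi> t - t * P / T" T 0 k, OF this] show ?thesis
        using \<open>T \<noteq> 0\<close> by (simp add: field_simps)
    qed
    obtain k :: int where k: "\<phi> 0 + of_int k * P \<in> {x - P..<x - P + P}"
      using reduce_mod_period[OF P] by blast
    have "\<phi> (of_int k * T) \<le> x" "x \<le> \<phi> (of_int (k + 1) * T)"
      unfolding int_shift using k by (auto simp: algebra_simps)
    then show ?thesis
      using IVT'[of \<phi> "of_int k * T" x "of_int (k + 1) * T"] isCont
        strict_mono_less_eq[OF mono] order_trans continuous_at_imp_continuous_on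
      by (metis UNIV_I)
  qed
  then obtain \<tau> where right: "\<And>x. \<phi> (\<tau> x) = x" by metis
  have left: "\<tau> (\<phi> t) = t" for t
    using right strict_mono_eq[OF mono] by blast
  moreover have "\<tau> (x + P) = \<tau> x + T" for x
    using left[of "\<tau> x + T"] by (simp add: shift right)
  moreover have "(\<tau> has_real_derivative inverse (\<phi>' (\<tau> x))) (at x)" for x
  proof (rule DERIV_inverse_function[OF d, where a = "x - 1" and b = "x + 1"])
    show "\<phi>' (\<tau> x) \<noteq> 0" using pos[of "\<tau> x"] by simp
    have "isCont \<tau> (\<phi> (\<tau> x))"
      by (rule isCont_inverse_function[of 1]) (auto simp: left isCont)
    then show "isCont \<tau> x" by (simp add: right)
  qed (use right in auto)
  ultimately show thesis using that right by blast
qed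

lemma positively_oriented_curve_normal_angle_parametrization:
  assumes M: "closed_regular_simple_curve M T" and pos: "positively_oriented M"
  obtains \<gamma> \<rho> where "normal_angle_parametrization M T \<gamma> \<rho>"
proof -
  from M have T: "0 < T" and per: "\<And>t. M (t + T) = M t"
    and nz: "\<And>t. velocity M t \<noteq> 0" and smooth: "smooth_curve M"
    by (auto simp: closed_regular_simple_curve_def)
  have vel: "(M has_vector_derivative velocity M t) (at t)" for t
    using smooth unfolding smooth_curve_def velocity_def
    by (metis funpow_0 vector_derivative_works)
  have "velocity M differentiable (at t)" for t
    using smooth unfolding smooth_curve_def by (metis One_nat_def funpow_0 funpow.simps(2) o_apply)
  then have contv: "continuous_on UNIV (velocity M)"
    by (meson continuous_at_imp_continuous_on differentiable_imp_continuous_within)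
  obtain \<phi> \<phi>' where d: "\<And>t. (\<phi> has_real_derivative \<phi>' t) (at t)" and \<phi>'_pos: "\<And>t. 0 < \<phi>' t"
    and cont\<phi>': "continuous_on UNIV \<phi>'" and polar: "\<And>t. velocity M t = norm (velocity M t) *\<^sub>R radial (\<phi> t)"
    and shift: "\<And>t. \<phi> (t + T) = \<phi> t + 2 * pi"
    using convex_curve_tangent_angle[OF M pos] by blast
  \<comment> \<open>The angle of the outer normal lags behind the tangent angle by a right angle.\<close>
  define N where "N = (\<lambda>t. \<phi> t - pi / 2)"
  have N: "(N has_real_derivative \<phi>' t) (at t)" "N (t + T) = N t + 2 * pi" for t
    unfolding N_def by (auto intro!: derivative_eq_intros d simp: shift)
  have pi2: "0 < 2 * pi" by simp
  obtain \<tau> where right: "\<And>x. N (\<tau> x) = x" and left: "\<And>t. \<tau> (N t) = t"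
    and \<tau>_shift: "\<And>x. \<tau> (x + 2 * pi) = \<tau> x + T"
    and \<tau>: "\<And>x. (\<tau> has_real_derivative inverse (\<phi>' (\<tau> x))) (at x)"
    using inverse_of_increasing_angle[OF N(1) \<phi>'_pos N(2) pi2] by blast
  have tangential: "velocity M (\<tau> \<theta>) = norm (velocity M (\<tau> \<theta>)) *\<^sub>R tangential \<theta>" for \<theta>
  proof -
    have "\<phi> (\<tau> \<theta>) = \<theta> + pi / 2" using right[of \<theta>] by (simp add: N_def)
    then have "radial (\<phi> (\<tau> \<theta>)) = tangential \<theta>" by (simp add: vec2_eq_iff cos_add sin_add)
    then show ?thesis using polar[of "\<tau> \<theta>"] by simp
  qed
  define \<rho> where "\<rho> = (\<lambda>\<theta>. norm (velocity M (\<tau> \<theta>)) * inverse (\<phi>' (\<tau> \<theta>)))"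
  have cont\<tau>: "continuous_on UNIV \<tau>"
    using \<tau> by (blast intro: DERIV_continuous continuous_at_imp_continuous_on)
  have cont\<rho>: "continuous_on UNIV \<rho>"
    unfolding \<rho>_def
    by (intro continuous_on_mult continuous_on_norm continuous_on_inverse
        continuous_on_compose2[OF contv cont\<tau>] continuous_on_compose2[OF cont\<phi>' cont\<tau>])
      (use \<phi>'_pos in \<open>auto simp: less_le\<close>)
  have "normal_angle_parametrization M T (\<lambda>\<theta>. M (\<tau> \<theta>)) \<rho>"
  proof
    show "range M = range (\<lambda>\<theta>. M (\<tau> \<theta>))"
      using left by (metis surjI image_image)
    show "((\<lambda>\<theta>. M (\<tau> \<theta>)) has_vector_derivative \<rho> \<theta> *\<^sub>R tangential \<theta>) (at \<theta>)" for \<theta>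
    proof -
      have "(M \<circ> \<tau> has_vector_derivative inverse (\<phi>' (\<tau> \<theta>)) *\<^sub>R velocity M (\<tau> \<theta>)) (at \<theta>)"
        using \<tau> vel by (intro vector_diff_chain_at) (auto simp: has_real_derivative_iff_has_vector_derivative)
      also have "inverse (\<phi>' (\<tau> \<theta>)) *\<^sub>R velocity M (\<tau> \<theta>) = \<rho> \<theta> *\<^sub>R tangential \<theta>"
        by (subst tangential) (simp add: \<rho>_def)
      finally show ?thesis by (simp add: o_def)
    qed
    show "0 < \<rho> \<theta>" for \<theta> using nz \<phi>'_pos by (simp add: \<rho>_def)
    show "continuous_on UNIV \<rho>" by (rule cont\<rho>)
    show "M (\<tau> (\<theta> + 2 * pi)) = M (\<tau> \<theta>)" for \<theta> by (simp add: \<tau>_shift per)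
    show "\<exists>s>0. tangent_vector M (M (\<tau> \<theta>)) = s *\<^sub>R tangential \<theta>" for \<theta>
      using tangential nz by (auto simp: tangent_vector_eq_velocity[OF M vel] intro!: exI[of _ "norm (velocity M (\<tau> \<theta>))"])
    show "curve_length M T = integral {0..2*pi} \<rho>"
    proof -
      obtain l where l: "\<And>t. (l has_real_derivative norm (velocity M t)) (at t)"
        using global_antiderivative[OF continuous_on_norm[OF contv]] by blast
      have "((\<lambda>\<theta>. l (\<tau> \<theta>)) has_real_derivative \<rho> \<theta>) (at \<theta>)" for \<theta>
        unfolding \<rho>_def by (rule DERIV_chain2[OF l \<tau>])
      from integral_of_derivative[OF this, of 0 "2*pi"]
      have "integral {0..2*pi} \<rho> = l (\<tau> 0 + T) - l (\<tau> 0)"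
        using \<tau>_shift[of 0] by simp
      also have "\<dots> = l (0 + T) - l 0"
        by (rule shifted_derivative_const_diff[OF l]) (simp add: periodic_derivative[OF vel per])
      also have "\<dots> = curve_length M T"
        unfolding curve_length_def using integral_of_derivative[OF l, of 0 T] T by simp
      finally show ?thesis by simp
    qed
  qed
  then show thesis by (rule that)
qed

theorem corollary5p5:
  fixes M :: "real \<Rightarrow> real ^ 2" and T :: real
  assumes "closed_regular_simple_curve M T"
    and "convex_curve M"
    and "positively_oriented M"
    and "0 \<in> inside (range M)"
  shows "(\<not> constant_width M \<longrightarrow>
            4 * \<bar>SMS_area M T\<bar> = 8 * \<bar>wigner_caustic_area M\<bar> + \<bar>CWMS_area M T\<bar>) \<and>
         (constant_width M \<longrightarrow> SMS M T = wigner_caustic M \<and> CWMS M T = {0})"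
proof -
  obtain \<gamma> \<rho> where "normal_angle_parametrization M T \<gamma> \<rho>"
    using positively_oriented_curve_normal_angle_parametrization assms(1,3) by blast
  then interpret normal_angle_parametrization M T \<gamma> \<rho> .
  show ?thesis
    using area_identity constant_width_sets by blast
qed

end
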